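(* Let $c$ be a real number and let $M$ be an Einstein $n$-manifold. If $M$ satisfies $$\delta_q^{\mathrm{Ric}}>\left(n-1-\frac{2q}{n}\right)c$$ for some positive integer $q\leq\frac{n}{2}$ at some point, then $M$ admits no totally real minimal isometric immersion into a complex space form of constant holomorphic sectional curvature $4c$, regardless of codimension.
   Context: Intrinsic notions. Let $M$ be a Riemannian $n$-manifold. $K(\pi)$ denotes the sectional curvature of a plane section $\pi\subset T_pM$. For a unit vector $X\in T_pM$, $\mathrm{Ric}(X)=\sum_{j=2}^n K(X\wedge e_j)$, where $\{e_1=X,e_2,\ldots,e_n\}$ is an orthonormal basis of $T_pM$. $M$ is Einstein if $\mathrm{Ric}(X)$ is independent of the choice of the unit vector $X$; then $\mathrm{Ric}(X)=\frac{2}{n}\tau(p)$ for every unit $X\in T_pM$, where $\tau(p)=\sum_{1\le i<j\le n}K(e_i\wedge e_j)$. For a positive integer $q\le n/2$ define $$K_q^{\inf}(p)=\inf_{\pi_1\perp\cdots\perp\pi_q}\frac{K(\pi_1)+\cdots+K(\pi_q)}{q},$$ where $\pi_1,\ldots,\pi_q$ run over all $q$ mutually orthogonal plane sections in $T_pM$, and define the function $\delta_q^{\mathrm{Ric}}$ on $M$ by $$\delta_q^{\mathrm{Ric}}(p)=\sup_{X\in T_p^1M}\mathrm{Ric}(X)-\frac{2q}{n}K_q^{\inf}(p),\qquad T_p^1M=\{X\in T_pM:\|X\|=1\}.$$ Extrinsic notions. A complex space form of constant holomorphic sectional curvature $4c$ is a Kähler manifold $N^m(4c)$, of some complex dimension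 $m$, with complex structure $J$ and constant holomorphic sectional curvature $4c$. An isometric immersion of $M$ into it is totally real if $J$ carries each tangent space $T_pM$ (identified with its image) into the corresponding normal space $T_p^\perp M$. With $h$ the second fundamental form of the immersion, the mean curvature vector is $\overrightarrow{H}=\frac1n\operatorname{trace}h$, and the immersion is minimal if $\overrightarrow{H}=0$. *)

theory Defs
  imports "HOL-Analysis.Analysis"
begin

section \<open>Smooth maps and smooth manifolds\<close>

text \<open>Only used for open sets \<open>S\<close>; for these, \<open>Ck_on k f S\<close> says that \<open>f\<close> is of class \<open>C\<^sup>k\<close>.\<close>

primrec Ck_on :: "nat \<Rightarrow> ('a::real_normed_vector \<Rightarrow> 'b::real_normed_vector) \<Rightarrow> 'a set \<Rightarrow> bool" where
  "Ck_on 0 f S \<longleftrightarrow> continuous_on S f"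
| "Ck_on (Suc k) f S \<longleftrightarrow> (\<forall>x\<in>S. f differentiable (at x)) \<and>
     (\<forall>v. Ck_on k (\<lambda>x. frechet_derivative f (at x) v) S)"

definition smooth_on :: "('a::real_normed_vector \<Rightarrow> 'b::real_normed_vector) \<Rightarrow> 'a set \<Rightarrow> bool" where
  "smooth_on f S \<longleftrightarrow> (\<forall>k. Ck_on k f S)"

text \<open>A chart is a pair of its domain and its coordinate map. Manifolds of dimension \<open>n\<close> are
  modelled on a Euclidean space \<open>'a\<close> with \<open>DIM('a) = n\<close>.\<close>

type_synonym ('p, 'a) chart = "'p set \<times> ('p \<Rightarrow> 'a)"

definition chart_inv :: "('p, 'a) chart \<Rightarrow> 'a \<Rightarrow> 'p" where
  "chart_inv \<phi> = inv_into (fst \<phi>) (snd \<phi>)"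

definition is_chart :: "'p topology \<Rightarrow> ('p, 'a::euclidean_space) chart \<Rightarrow> bool" where
  "is_chart X \<phi> \<longleftrightarrow> openin X (fst \<phi>) \<and> open (snd \<phi> ` fst \<phi>) \<and>
     homeomorphic_map (subtopology X (fst \<phi>)) (top_of_set (snd \<phi> ` fst \<phi>)) (snd \<phi>)"

definition transition :: "('p, 'a) chart \<Rightarrow> ('p, 'a) chart \<Rightarrow> 'a \<Rightarrow> 'a" where
  "transition \<phi> \<psi> = snd \<psi> \<circ> chart_inv \<phi>"

definition overlap :: "('p, 'a) chart \<Rightarrow> ('p, 'a) chart \<Rightarrow> 'a set" where
  "overlap \<phi> \<psi> = snd \<phi> ` (fst \<phi> \<inter> fst \<psi>)"

definition smooth_manifold :: "'p topology \<Rightarrow> ('p, 'a::euclidean_space) chart set \<Rightarrow> bool" where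
  "smooth_manifold X \<A> \<longleftrightarrow> Hausdorff_space X \<and> second_countable X \<and>
     (\<forall>\<phi>\<in>\<A>. is_chart X \<phi>) \<and> (\<Union>\<phi>\<in>\<A>. fst \<phi>) = topspace X \<and>
     (\<forall>\<phi>\<in>\<A>. \<forall>\<psi>\<in>\<A>. smooth_on (transition \<phi> \<psi>) (overlap \<phi> \<psi>))"

section \<open>Riemannian manifolds\<close>

text \<open>The Riemannian metric is given by its local expressions: \<open>metric M \<phi> x u v\<close> is the inner
  product, at the point with coordinates \<open>x\<close> in the chart \<open>\<phi>\<close>, of the tangent vectors whose
  components in \<open>\<phi>\<close> are \<open>u\<close> and \<open>v\<close>. It is irrelevant for \<open>x\<close> outside the image of \<open>\<phi>\<close>.\<close>

type_synonym 'a local_metric = "'a \<Rightarrow> 'a \<Rightarrow> 'a \<Rightarrow> real"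

record ('p, 'a) riem_space =
  top_sp :: "'p topology"
  atlas :: "('p, 'a) chart set"
  metric :: "('p, 'a) chart \<Rightarrow> 'a local_metric"

definition riemannian_manifold :: "('p, 'a::euclidean_space) riem_space \<Rightarrow> bool" where
  "riemannian_manifold M \<longleftrightarrow> smooth_manifold (top_sp M) (atlas M) \<and>
     (\<forall>\<phi>\<in>atlas M.
        (\<forall>x\<in>snd \<phi> ` fst \<phi>.
           bilinear (metric M \<phi> x) \<and>
           (\<forall>u v. metric M \<phi> x u v = metric M \<phi> x v u) \<and>
           (\<forall>u. u \<noteq> 0 \<longrightarrow> 0 < metric M \<phi> x u u)) \<and>
        (\<forall>u v. smooth_on (\<lambda>x. metric M \<phi> x u v) (snd \<phi> ` fst \<phi>))) \<and>
     (\<forall>\<phi>\<in>atlas M. \<forall>\<psi>\<in>atlas M. \<forall>x\<in>overlap \<phi> \<psi>. \<forall>u v.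
        metric M \<phi> x u v =
          metric M \<psi> (transition \<phi> \<psi> x)
            (frechet_derivative (transition \<phi> \<psi>) (at x) u)
            (frechet_derivative (transition \<phi> \<psi>) (at x) v))"

text \<open>The tangent space at \<open>p\<close> is the model space \<open>'a\<close>, a tangent vector being identified with its
  components in one chosen chart at \<open>p\<close>. All tensors below are evaluated at \<open>p\<close> in that chart.\<close>

definition chart_at :: "('p, 'a::euclidean_space) riem_space \<Rightarrow> 'p \<Rightarrow> ('p, 'a) chart" where
  "chart_at M p = (SOME \<phi>. \<phi> \<in> atlas M \<and> p \<in> fst \<phi>)"

definition coords_at :: "('p, 'a::euclidean_space) riem_space \<Rightarrow> 'p \<Rightarrow> 'a" where
  "coords_at M p = snd (chart_at M p) p"

definition metric_near :: "('p, 'a::euclidean_space) riem_space \<Rightarrow> 'p \<Rightarrow> 'a local_metric" where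
  "metric_near M p = metric M (chart_at M p)"

definition metric_at :: "('p, 'a::euclidean_space) riem_space \<Rightarrow> 'p \<Rightarrow> 'a \<Rightarrow> 'a \<Rightarrow> real" where
  "metric_at M p = metric_near M p (coords_at M p)"

section \<open>Levi-Civita connection and curvature\<close>

text \<open>\<open>christoffel g x u v\<close> is the value at \<open>x\<close> of \<open>\<nabla>\<^sub>U V\<close> for the coordinate-constant fields
  \<open>U = u\<close>, \<open>V = v\<close>, as determined by the Koszul formula; so for general \<open>V\<close> one has
  \<open>\<nabla>\<^sub>u V = D V(x) u + christoffel g x u (V x)\<close>.\<close>

definition dmetric :: "'a::euclidean_space local_metric \<Rightarrow> 'a \<Rightarrow> 'a \<Rightarrow> 'a \<Rightarrow> 'a \<Rightarrow> real" where
  "dmetric g x w u v = frechet_derivative (\<lambda>y. g y u v) (at x) w"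

definition christoffel :: "'a::euclidean_space local_metric \<Rightarrow> 'a \<Rightarrow> 'a \<Rightarrow> 'a \<Rightarrow> 'a" where
  "christoffel g x u v =
     (THE w. \<forall>z. 2 * g x w z = dmetric g x u v z + dmetric g x v u z - dmetric g x z u v)"

text \<open>Curvature convention: \<open>R(u,v)w = \<nabla>\<^sub>u \<nabla>\<^sub>v w - \<nabla>\<^sub>v \<nabla>\<^sub>u w - \<nabla>\<^bsub>[u,v]\<^esub> w\<close>, the bracket being \<open>0\<close> for
  coordinate-constant fields.\<close>

definition curvature :: "'a::euclidean_space local_metric \<Rightarrow> 'a \<Rightarrow> 'a \<Rightarrow> 'a \<Rightarrow> 'a \<Rightarrow> 'a" where
  "curvature g x u v w =
     (frechet_derivative (\<lambda>y. christoffel g y v w) (at x) u + christoffel g x u (christoffel g x v w)) -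
     (frechet_derivative (\<lambda>y. christoffel g y u w) (at x) v + christoffel g x v (christoffel g x u w))"

definition plane_section :: "'a::euclidean_space set \<Rightarrow> bool" where
  "plane_section \<pi> \<longleftrightarrow> subspace \<pi> \<and> dim \<pi> = 2"

text \<open>The value does not depend on the basis \<open>(u, v)\<close> of \<open>\<pi>\<close>.\<close>

definition sectional_curvature ::
    "('p, 'a::euclidean_space) riem_space \<Rightarrow> 'p \<Rightarrow> 'a set \<Rightarrow> real" where
  "sectional_curvature M p \<pi> =
     (let (u, v) = (SOME (u, v). u \<noteq> v \<and> independent {u, v} \<and> span {u, v} = \<pi>); g = metric_at M p
      in g (curvature (metric_near M p) (coords_at M p) u v v) u / (g u u * g v v - (g u v)\<^sup>2))"

section \<open>Ricci curvature, Einstein manifolds and \<open>\<delta>\<close>-invariants\<close>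

definition orthonormal_basis :: "('a::euclidean_space \<Rightarrow> 'a \<Rightarrow> real) \<Rightarrow> 'a set \<Rightarrow> bool" where
  "orthonormal_basis g B \<longleftrightarrow> span B = UNIV \<and> (\<forall>u\<in>B. \<forall>v\<in>B. g u v = (if u = v then 1 else 0))"

definition unit_tangent :: "('p, 'a::euclidean_space) riem_space \<Rightarrow> 'p \<Rightarrow> 'a set" where
  "unit_tangent M p = {u. metric_at M p u u = 1}"

text \<open>The value does not depend on the orthonormal basis extending \<open>u\<close>.\<close>

definition ricci :: "('p, 'a::euclidean_space) riem_space \<Rightarrow> 'p \<Rightarrow> 'a \<Rightarrow> real" where
  "ricci M p u =
     (let B = (SOME B. orthonormal_basis (metric_at M p) B \<and> u \<in> B)
      in \<Sum>e\<in>B - {u}. sectional_curvature M p (span {u, e}))"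

definition einstein :: "('p, 'a::euclidean_space) riem_space \<Rightarrow> bool" where
  "einstein M \<longleftrightarrow>
     (\<forall>p\<in>topspace (top_sp M). \<forall>u\<in>unit_tangent M p. \<forall>v\<in>unit_tangent M p. ricci M p u = ricci M p v)"

definition orthogonal_planes ::
    "('p, 'a::euclidean_space) riem_space \<Rightarrow> 'p \<Rightarrow> nat \<Rightarrow> (nat \<Rightarrow> 'a set) \<Rightarrow> bool" where
  "orthogonal_planes M p q \<pi> \<longleftrightarrow> (\<forall>i<q. plane_section (\<pi> i)) \<and>
     (\<forall>i<q. \<forall>j<q. i \<noteq> j \<longrightarrow> (\<forall>u\<in>\<pi> i. \<forall>v\<in>\<pi> j. metric_at M p u v = 0))"

definition K_inf :: "('p, 'a::euclidean_space) riem_space \<Rightarrow> nat \<Rightarrow> 'p \<Rightarrow> real" where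
  "K_inf M q p =
     Inf {(\<Sum>i<q. sectional_curvature M p (\<pi> i)) / real q |\<pi>. orthogonal_planes M p q \<pi>}"

definition delta_Ric :: "('p, 'a::euclidean_space) riem_space \<Rightarrow> nat \<Rightarrow> 'p \<Rightarrow> real" where
  "delta_Ric M q p =
     (SUP u\<in>unit_tangent M p. ricci M p u) - 2 * real q / real DIM('a) * K_inf M q p"

section \<open>Complex space forms\<close>

text \<open>A complex manifold of complex dimension \<open>CARD('m)\<close> is a smooth manifold modelled on
  \<open>complex^'m\<close>, regarded as a real vector space, with holomorphic transition maps. Its complex
  structure \<open>J\<close> is then multiplication by \<open>\<i>\<close> on components in every chart.\<close>

definition J :: "complex^'m \<Rightarrow> complex^'m" where
  "J v = \<i> *s v"

definition complex_atlas :: "('p, complex^'m) chart set \<Rightarrow> bool" where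
  "complex_atlas \<A> \<longleftrightarrow> (\<forall>\<phi>\<in>\<A>. \<forall>\<psi>\<in>\<A>. \<forall>x\<in>overlap \<phi> \<psi>. \<forall>v.
     frechet_derivative (transition \<phi> \<psi>) (at x) (J v) = J (frechet_derivative (transition \<phi> \<psi>) (at x) v))"

text \<open>The last conjunct states that the Kaehler form \<open>\<omega>(u,v) = g(J u, v)\<close> is closed.\<close>

definition kaehler_manifold :: "('p, complex^'m) riem_space \<Rightarrow> bool" where
  "kaehler_manifold N \<longleftrightarrow> riemannian_manifold N \<and> complex_atlas (atlas N) \<and>
     (\<forall>\<phi>\<in>atlas N. \<forall>x\<in>snd \<phi> ` fst \<phi>.
        (\<forall>u v. metric N \<phi> x (J u) (J v) = metric N \<phi> x u v) \<and>
        (\<forall>u v w. dmetric (metric N \<phi>) x u (J v) w + dmetric (metric N \<phi>) x v (J w) u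
           + dmetric (metric N \<phi>) x w (J u) v = 0))"

definition complex_space_form :: "('p, complex^'m) riem_space \<Rightarrow> real \<Rightarrow> bool" where
  "complex_space_form N k \<longleftrightarrow> kaehler_manifold N \<and>
     (\<forall>p\<in>topspace (top_sp N). \<forall>u. u \<noteq> 0 \<longrightarrow> sectional_curvature N p (span {u, J u}) = k)"

section \<open>Immersions\<close>

definition local_rep ::
    "('p, 'a) chart \<Rightarrow> ('q, 'b) chart \<Rightarrow> ('p \<Rightarrow> 'q) \<Rightarrow> 'a \<Rightarrow> 'b" where
  "local_rep \<phi> \<psi> f = snd \<psi> \<circ> f \<circ> chart_inv \<phi>"

definition smooth_map :: "('p, 'a::euclidean_space) riem_space \<Rightarrow> ('q, 'b::euclidean_space) riem_space \<Rightarrow>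
    ('p \<Rightarrow> 'q) \<Rightarrow> bool" where
  "smooth_map M N f \<longleftrightarrow> continuous_map (top_sp M) (top_sp N) f \<and>
     (\<forall>\<phi>\<in>atlas M. \<forall>\<psi>\<in>atlas N. smooth_on (local_rep \<phi> \<psi> f) (snd \<phi> ` (fst \<phi> \<inter> f -` fst \<psi>)))"

definition rep_at :: "('p, 'a::euclidean_space) riem_space \<Rightarrow> ('q, 'b::euclidean_space) riem_space \<Rightarrow>
    ('p \<Rightarrow> 'q) \<Rightarrow> 'p \<Rightarrow> 'a \<Rightarrow> 'b" where
  "rep_at M N f p = local_rep (chart_at M p) (chart_at N (f p)) f"

definition tangent_map :: "('p, 'a::euclidean_space) riem_space \<Rightarrow> ('q, 'b::euclidean_space) riem_space \<Rightarrow>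
    ('p \<Rightarrow> 'q) \<Rightarrow> 'p \<Rightarrow> 'a \<Rightarrow> 'b" where
  "tangent_map M N f p = frechet_derivative (rep_at M N f p) (at (coords_at M p))"

text \<open>Since the metric of \<open>M\<close> is positive definite, the metric condition makes every
  \<open>tangent_map M N f p\<close> injective.\<close>

definition isometric_immersion :: "('p, 'a::euclidean_space) riem_space \<Rightarrow>
    ('q, 'b::euclidean_space) riem_space \<Rightarrow> ('p \<Rightarrow> 'q) \<Rightarrow> bool" where
  "isometric_immersion M N f \<longleftrightarrow> smooth_map M N f \<and>
     (\<forall>p\<in>topspace (top_sp M). \<forall>u v.
        metric_at N (f p) (tangent_map M N f p u) (tangent_map M N f p v) = metric_at M p u v)"

definition normal_space :: "('p, 'a::euclidean_space) riem_space \<Rightarrow> ('q, 'b::euclidean_space) riem_space \<Rightarrow>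
    ('p \<Rightarrow> 'q) \<Rightarrow> 'p \<Rightarrow> 'b set" where
  "normal_space M N f p = {\<xi>. \<forall>u. metric_at N (f p) \<xi> (tangent_map M N f p u) = 0}"

definition normal_part :: "('p, 'a::euclidean_space) riem_space \<Rightarrow> ('q, 'b::euclidean_space) riem_space \<Rightarrow>
    ('p \<Rightarrow> 'q) \<Rightarrow> 'p \<Rightarrow> 'b \<Rightarrow> 'b" where
  "normal_part M N f p w =
     (THE \<xi>. \<xi> \<in> normal_space M N f p \<and> w - \<xi> \<in> range (tangent_map M N f p))"

text \<open>\<open>h(u,v)\<close> is the normal part of the ambient covariant derivative, in the direction \<open>df(u)\<close>, of
  \<open>df(V)\<close> for the coordinate-constant field \<open>V = v\<close> on \<open>M\<close>.\<close>

definition second_fundamental_form :: "('p, 'a::euclidean_space) riem_space \<Rightarrow>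
    ('q, 'b::euclidean_space) riem_space \<Rightarrow> ('p \<Rightarrow> 'q) \<Rightarrow> 'p \<Rightarrow> 'a \<Rightarrow> 'a \<Rightarrow> 'b" where
  "second_fundamental_form M N f p u v = normal_part M N f p
     (frechet_derivative (\<lambda>y. frechet_derivative (rep_at M N f p) (at y) v) (at (coords_at M p)) u
      + christoffel (metric_near N (f p)) (coords_at N (f p))
          (tangent_map M N f p u) (tangent_map M N f p v))"

text \<open>The trace is taken over any orthonormal basis of the tangent space.\<close>

definition mean_curvature :: "('p, 'a::euclidean_space) riem_space \<Rightarrow>
    ('q, 'b::euclidean_space) riem_space \<Rightarrow> ('p \<Rightarrow> 'q) \<Rightarrow> 'p \<Rightarrow> 'b" where
  "mean_curvature M N f p =
     (1 / real DIM('a)) *\<^sub>R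
       (\<Sum>e\<in>(SOME B. orthonormal_basis (metric_at M p) B). second_fundamental_form M N f p e e)"

definition minimal_immersion :: "('p, 'a::euclidean_space) riem_space \<Rightarrow>
    ('q, 'b::euclidean_space) riem_space \<Rightarrow> ('p \<Rightarrow> 'q) \<Rightarrow> bool" where
  "minimal_immersion M N f \<longleftrightarrow> (\<forall>p\<in>topspace (top_sp M). mean_curvature M N f p = 0)"

definition totally_real :: "('p, 'a::euclidean_space) riem_space \<Rightarrow>
    ('q, complex^'m) riem_space \<Rightarrow> ('p \<Rightarrow> 'q) \<Rightarrow> bool" where
  "totally_real M N f \<longleftrightarrow>
     (\<forall>p\<in>topspace (top_sp M). J ` range (tangent_map M N f p) \<subseteq> normal_space M N f p)"

end

theory Submission
  imports Defs
begin

text \<open>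
  A complex space form has \<open>K(X \<and> Y) = c\<close> on totally real planes, so for a minimal totally real
  immersion with second fundamental form \<open>h\<close> the Gauss equation reads
  \<open>K(u \<and> v) = c + \<langle>h(u,u), h(v,v)\<rangle> - |h(u,v)|\<^sup>2\<close> for orthonormal \<open>u, v\<close>. Summing over an orthonormal basis and
  using \<open>trace h = 0\<close>, the constant value \<open>\<rho>\<close> of the Ricci curvature of an Einstein manifold satisfies
  \<open>n \<rho> = n (n - 1) c - |h|\<^sup>2\<close>. For orthogonal planes \<open>\<pi>\<^sub>i\<close> with orthonormal bases \<open>(a\<^sub>i, b\<^sub>i)\<close>,
  \<open>|h|\<^sup>2 + 2 \<Sum> (K(\<pi>\<^sub>i) - c) \<ge> \<Sum> |h(a\<^sub>i,a\<^sub>i) + h(b\<^sub>i,b\<^sub>i)|\<^sup>2 \<ge> 0\<close>. Together these give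
  \<open>\<rho> - (2/n) \<Sum> K(\<pi>\<^sub>i) \<le> (n - 1 - 2q/n) c\<close>.
\<close>

section \<open>Smooth maps\<close>

text \<open>The definitions select charts, bases and projections by \<open>SOME\<close> and
  \<open>THE\<close>, and they state the isometry condition at each point in that point's own
  charts. Gauss's equation differentiates that condition, so it needs it on a neighbourhood in one
  fixed pair of charts. The geometry is therefore done in locales for local metrics, and
  independence of the choices is proved as needed.

  The value c on totally real planes comes from 4c on holomorphic planes by polarization: the
  curvature of a plane is a combination of values of the quartic form Q u = R(u, J u, J u, u), once
  J commutes with the curvature. This holds because J is parallel, which follows from closedness of
  the Kaehler form by Koszul's formula.

  The estimate for orthogonal planes uses a basis adapted to them: |h|^2 is at least its part in the
  q diagonal two-by-two blocks, and each block plus 2 (K - c) is a squared norm. Dividing the Ricci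
  identity by n produces the weight 2/n of the invariant. The bound q <= n/2 makes the set of plane
  families nonempty, so that a lower bound for its elements bounds the infimum.\<close>

abbreviation D :: "('a::real_normed_vector \<Rightarrow> 'b::real_normed_vector) \<Rightarrow> 'a \<Rightarrow> 'a \<Rightarrow> 'b" where
  "D f x \<equiv> frechet_derivative f (at x)"

lemma D_works: "f differentiable (at x) \<Longrightarrow> (f has_derivative D f x) (at x)"
  by (simp add: frechet_derivative_works)

lemma D_eq: "(f has_derivative f') (at x) \<Longrightarrow> D f x = f'"
  by (simp add: frechet_derivative_at[symmetric])

lemma has_derivative_D_compose:
  assumes "(p has_derivative p') (at s within T)" "f differentiable (at (p s))"
  shows "((\<lambda>s. f (p s)) has_derivative (\<lambda>h. D f (p s) (p' h))) (at s within T)"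
  using has_derivative_compose[OF assms(1) D_works[OF assms(2)]] .

lemma smooth_on_differentiable: "smooth_on f S \<Longrightarrow> x \<in> S \<Longrightarrow> f differentiable (at x)"
  unfolding smooth_on_def by (metis Ck_on.simps(2))

lemma smooth_on_D: "smooth_on f S \<Longrightarrow> smooth_on (\<lambda>x. D f x v) S"
  unfolding smooth_on_def by (metis Ck_on.simps(2))

lemma smooth_on_continuous: "smooth_on f S \<Longrightarrow> continuous_on S f"
  unfolding smooth_on_def by (metis Ck_on.simps(1))

lemma smooth_on_D_works: "smooth_on f S \<Longrightarrow> x \<in> S \<Longrightarrow> (f has_derivative D f x) (at x)"
  by (simp add: D_works smooth_on_differentiable)

section \<open>Symmetry of second derivatives\<close>

lemma second_difference_mvt:
  fixes f :: "'a::real_normed_vector \<Rightarrow> real"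
  assumes f: "\<And>y. y \<in> S \<Longrightarrow> f differentiable (at y)"
    and fu: "\<And>y. y \<in> S \<Longrightarrow> (\<lambda>z. D f z u) differentiable (at y)"
    and t: "0 < t" and S: "\<And>a b. \<lbrakk>0 \<le> a; a \<le> t; 0 \<le> b; b \<le> t\<rbrakk> \<Longrightarrow> x + a *\<^sub>R u + b *\<^sub>R v \<in> S"
  shows "\<exists>a b. 0 \<le> a \<and> a \<le> t \<and> 0 \<le> b \<and> b \<le> t \<and>
    f (x + t *\<^sub>R u + t *\<^sub>R v) - f (x + t *\<^sub>R u) - f (x + t *\<^sub>R v) + f x =
    t * t * D (\<lambda>z. D f z u) (x + a *\<^sub>R u + b *\<^sub>R v) v"
proof -
  \<comment> \<open>Two mean value theorems: along u for the increment of f across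
    \<open>t *\<^sub>R v\<close>, then along v for the derivative of f in direction u at the point
    just found.\<close>
  let ?\<phi> = "\<lambda>s. f (x + s *\<^sub>R u + t *\<^sub>R v) - f (x + s *\<^sub>R u)"
  have "(?\<phi> has_derivative (\<lambda>h. D f (x + s *\<^sub>R u + t *\<^sub>R v) (h *\<^sub>R u) - D f (x + s *\<^sub>R u) (h *\<^sub>R u)))
      (at s within {0..t})" if "0 \<le> s" "s \<le> t" for s
  proof -
    have 1: "f differentiable (at (x + s *\<^sub>R u + t *\<^sub>R v))"
      using S[of s t] that t f by auto
    have 2: "f differentiable (at (x + s *\<^sub>R u))"
      using S[of s 0] that t f by auto
    show ?thesis
      by (rule has_derivative_diff has_derivative_D_compose[where p = "\<lambda>s. x + s *\<^sub>R u + t *\<^sub>R v", OF _ 1]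
          has_derivative_D_compose[where p = "\<lambda>s. x + s *\<^sub>R u", OF _ 2] derivative_eq_intros refl)+ simp_all
  qed
  from mvt_simple[OF t this] obtain a where a: "a \<in> {0<..<t}"
    and "?\<phi> t - ?\<phi> 0 = D f (x + a *\<^sub>R u + t *\<^sub>R v) (t *\<^sub>R u) - D f (x + a *\<^sub>R u) (t *\<^sub>R u)"
    by auto
  moreover have "linear (D f (x + a *\<^sub>R u + t *\<^sub>R v))" "linear (D f (x + a *\<^sub>R u))"
    using S[of a t] S[of a 0] a t by (auto intro!: linear_frechet_derivative f)
  ultimately have e1: "?\<phi> t - ?\<phi> 0 = t * (D f (x + a *\<^sub>R u + t *\<^sub>R v) u - D f (x + a *\<^sub>R u) u)"
    by (simp add: linear_cmul algebra_simps)
  let ?\<psi> = "\<lambda>s. D f (x + a *\<^sub>R u + s *\<^sub>R v) u"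
  have "(?\<psi> has_derivative (\<lambda>h. D (\<lambda>z. D f z u) (x + a *\<^sub>R u + s *\<^sub>R v) (h *\<^sub>R v))) (at s within {0..t})"
    if "0 \<le> s" "s \<le> t" for s
  proof -
    have 1: "(\<lambda>z. D f z u) differentiable (at (x + a *\<^sub>R u + s *\<^sub>R v))"
      using S[of a s] that a by (intro fu) auto
    show ?thesis
      by (rule has_derivative_D_compose[where p = "\<lambda>s. x + a *\<^sub>R u + s *\<^sub>R v" and f = "\<lambda>z. D f z u", OF _ 1]
          derivative_eq_intros refl)+ simp_all
  qed
  from mvt_simple[OF t this] obtain b where b: "b \<in> {0<..<t}"
    and "?\<psi> t - ?\<psi> 0 = D (\<lambda>z. D f z u) (x + a *\<^sub>R u + b *\<^sub>R v) (t *\<^sub>R v)"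
    by auto
  moreover have "linear (D (\<lambda>z. D f z u) (x + a *\<^sub>R u + b *\<^sub>R v))"
    using S[of a b] a b t by (intro linear_frechet_derivative fu) auto
  ultimately have e2: "?\<psi> t - ?\<psi> 0 = t * D (\<lambda>z. D f z u) (x + a *\<^sub>R u + b *\<^sub>R v) v"
    by (simp add: linear_cmul)
  show ?thesis
    using a b e1 e2 by (intro exI[of _ a] exI[of _ b]) auto
qed

text \<open>The second difference over a small parallelogram is symmetric in u and v, while the mean
  value theorem in either order writes it as t * t times a mixed derivative at a nearby point.
  Continuity of both mixed derivatives then excludes a gap between them.\<close>

lemma second_derivative_symmetric_real:
  fixes f :: "'a::real_normed_vector \<Rightarrow> real"
  assumes "open S" "x \<in> S" and f: "smooth_on f S"
  shows "D (\<lambda>z. D f z u) x v = D (\<lambda>z. D f z v) x u"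
proof (rule ccontr)
  define A where "A y = D (\<lambda>z. D f z u) y v" for y
  define B where "B y = D (\<lambda>z. D f z v) y u" for y
  assume "\<not> ?thesis"
  \<comment> \<open>Half the gap, so that two errors below it cannot bridge it.\<close>
  then have ne: "\<bar>A x - B x\<bar> / 2 > 0" (is "?e > 0") by (simp add: A_def B_def)
  have "isCont A x" "isCont B x"
    unfolding A_def B_def
    using smooth_on_continuous[OF smooth_on_D[OF smooth_on_D[OF f]]] assms
    by (auto simp: continuous_on_eq_continuous_at)
  then obtain d1 d2 where d: "d1 > 0" "\<And>y. dist y x < d1 \<Longrightarrow> dist (A y) (A x) < ?e"
    "d2 > 0" "\<And>y. dist y x < d2 \<Longrightarrow> dist (B y) (B x) < ?e"
    using ne unfolding continuous_at_eps_delta by metis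
  obtain d3 where d3: "d3 > 0" "\<And>y. dist y x < d3 \<Longrightarrow> y \<in> S"
    using assms unfolding open_dist by metis
  define d where "d = min d1 (min d2 d3)"
  have d0: "d > 0" using d d3 by (simp add: d_def)
  \<comment> \<open>This keeps the parallelogram within distance d of x. The + 1 makes the divisor
    positive even for u = v = 0 and the distance bound strict.\<close>
  define t where "t = d / (norm u + norm v + 1)"
  have nn: "norm u + norm v + 1 > 0" by (simp add: add_nonneg_pos)
  then have t: "t > 0" using d0 by (simp add: t_def)
  have near: "dist (x + a *\<^sub>R u + b *\<^sub>R v) x < d" if "0 \<le> a" "a \<le> t" "0 \<le> b" "b \<le> t" for a b
  proof -
    have "dist (x + a *\<^sub>R u + b *\<^sub>R v) x \<le> a * norm u + b * norm v"
      using norm_triangle_ineq[of "a *\<^sub>R u" "b *\<^sub>R v"] that by (simp add: dist_norm)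
    also have "\<dots> \<le> t * norm u + t * norm v"
      using that by (intro add_mono mult_right_mono) auto
    also have "\<dots> < t * (norm u + norm v + 1)" using t by (simp add: algebra_simps)
    also have "\<dots> = d" using nn by (simp add: t_def)
    finally show ?thesis .
  qed
  have near': "dist (x + b *\<^sub>R v + a *\<^sub>R u) x < d" if "0 \<le> a" "a \<le> t" "0 \<le> b" "b \<le> t" for a b
    using near[OF that] by (simp add: add.commute add.left_commute)
  let ?d = "f (x + t *\<^sub>R u + t *\<^sub>R v) - f (x + t *\<^sub>R u) - f (x + t *\<^sub>R v) + f x"
  obtain a b where ab: "0 \<le> a" "a \<le> t" "0 \<le> b" "b \<le> t"
    and 1: "?d = t * t * A (x + a *\<^sub>R u + b *\<^sub>R v)"
    unfolding A_def
    using second_difference_mvt[of S f u t x v] smooth_on_differentiable[OF f]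
      smooth_on_differentiable[OF smooth_on_D[OF f]] t near d3 by (fastforce simp: d_def)
  obtain a' b' where ab': "0 \<le> a'" "a' \<le> t" "0 \<le> b'" "b' \<le> t"
    and 2: "f (x + t *\<^sub>R v + t *\<^sub>R u) - f (x + t *\<^sub>R v) - f (x + t *\<^sub>R u) + f x
      = t * t * B (x + b' *\<^sub>R v + a' *\<^sub>R u)"
    unfolding B_def
    using second_difference_mvt[of S f v t x u] smooth_on_differentiable[OF f]
      smooth_on_differentiable[OF smooth_on_D[OF f]] t near' d3 by (fastforce simp: d_def)
  have "?d = t * t * B (x + b' *\<^sub>R v + a' *\<^sub>R u)"
    using 2 by (simp add: add.commute add.left_commute)
  with 1 have "A (x + a *\<^sub>R u + b *\<^sub>R v) = B (x + b' *\<^sub>R v + a' *\<^sub>R u)"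
    using t by simp
  moreover have "dist (A (x + a *\<^sub>R u + b *\<^sub>R v)) (A x) < ?e"
    using near[OF ab] by (intro d) (simp add: d_def)
  moreover have "dist (B (x + b' *\<^sub>R v + a' *\<^sub>R u)) (B x) < ?e"
    using near'[OF ab'] by (intro d) (simp add: d_def)
  moreover have "dist (A x) (B x) \<le> dist (A (x + a *\<^sub>R u + b *\<^sub>R v)) (A x) + dist (A (x + a *\<^sub>R u + b *\<^sub>R v)) (B x)"
    by (rule dist_triangle3)
  moreover have "dist (A x) (B x) = \<bar>A x - B x\<bar>" by (rule dist_real_def)
  ultimately show False by simp
qed

lemma bounded_linear_differentiable:
  "bounded_linear L \<Longrightarrow> f differentiable (at x) \<Longrightarrow> (\<lambda>y. L (f y)) differentiable (at x)"
  unfolding differentiable_def by (blast intro: bounded_linear.has_derivative)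

lemma D_bounded_linear_comp:
  assumes "bounded_linear L" "f differentiable (at x)"
  shows "D (\<lambda>y. L (f y)) x v = L (D f x v)"
  using D_eq[OF bounded_linear.has_derivative[OF assms(1) D_works[OF assms(2)]]] by simp

lemma Ck_on_cong: "open S \<Longrightarrow> (\<And>x. x \<in> S \<Longrightarrow> f x = g x) \<Longrightarrow> Ck_on k f S = Ck_on k g S"
proof (induction k arbitrary: f g)
  case 0
  then show ?case by (simp cong: continuous_on_cong)
next
  case (Suc k)
  have d: "f differentiable (at x) \<longleftrightarrow> g differentiable (at x)" if "x \<in> S" for x
    using Suc.prems that has_derivative_transform_within_open[of f _ x UNIV S g]
      has_derivative_transform_within_open[of g _ x UNIV S f]
    unfolding differentiable_def by metis
  show ?case
  proof (cases "\<forall>x\<in>S. f differentiable (at x)")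
    case True
    have "Ck_on k (\<lambda>x. D f x v) S = Ck_on k (\<lambda>x. D g x v) S" for v
      using Suc.prems True
      by (intro Suc.IH) (auto intro!: frechet_derivative_transform_within_open[THEN fun_cong])
    then show ?thesis using d by simp
  qed (use d in auto)
qed

lemma Ck_on_bounded_linear_comp:
  assumes L: "bounded_linear L" and "open S"
  shows "Ck_on k f S \<Longrightarrow> Ck_on k (\<lambda>x. L (f x)) S"
proof (induction k arbitrary: f)
  case 0
  then show ?case using L by (auto intro: bounded_linear.continuous_on)
next
  case (Suc k)
  have "Ck_on k (\<lambda>x. D (\<lambda>y. L (f y)) x v) S" for v
    using Suc Ck_on_cong[OF \<open>open S\<close>, of "\<lambda>x. D (\<lambda>y. L (f y)) x v" "\<lambda>x. L (D f x v)"]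
    by (auto simp: D_bounded_linear_comp[OF L])
  then show ?case
    using Suc.prems bounded_linear_differentiable[OF L] by auto
qed

lemma second_derivative_symmetric:
  fixes f :: "'a::real_normed_vector \<Rightarrow> 'b::euclidean_space"
  assumes "open S" "x \<in> S" and f: "smooth_on f S"
  shows "D (\<lambda>z. D f z u) x v = D (\<lambda>z. D f z v) x u"
proof (rule euclidean_eqI)
  fix b :: 'b assume "b \<in> Basis"
  have L: "bounded_linear (\<lambda>y. y \<bullet> b)" by (rule bounded_linear_inner_left)
  have s: "smooth_on (\<lambda>y. f y \<bullet> b) S"
    using f Ck_on_bounded_linear_comp[OF L \<open>open S\<close>] unfolding smooth_on_def by blast
  have *: "D (\<lambda>z. D (\<lambda>y. f y \<bullet> b) z u) x v = D (\<lambda>z. D f z u) x v \<bullet> b" for u v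
  proof -
    have "D (\<lambda>z. D f z u \<bullet> b) x v = D (\<lambda>z. D (\<lambda>y. f y \<bullet> b) z u) x v"
      using smooth_on_differentiable[OF smooth_on_D[OF f]]
      by (intro frechet_derivative_transform_within_open[THEN fun_cong])
        (use assms smooth_on_differentiable[OF f] in
          \<open>auto intro!: bounded_linear_differentiable[OF L] simp: D_bounded_linear_comp[OF L]\<close>)
    then show ?thesis
      by (simp add: D_bounded_linear_comp[OF L] smooth_on_differentiable[OF smooth_on_D[OF f] assms(2)])
  qed
  show "D (\<lambda>z. D f z u) x v \<bullet> b = D (\<lambda>z. D f z v) x u \<bullet> b"
    using second_derivative_symmetric_real[OF assms(1,2) s, of u v] by (simp add: *)
qed

section \<open>Product rules for fields of bilinear maps\<close>

lemma bilinear_expand: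
  fixes u :: "'a::euclidean_space" and v :: "'b::euclidean_space"
  assumes "bilinear \<beta>"
  shows "\<beta> u v = (\<Sum>i\<in>Basis. \<Sum>j\<in>Basis. ((u \<bullet> i) * (v \<bullet> j)) *\<^sub>R \<beta> i j)"
proof -
  have "\<beta> u v = \<beta> (\<Sum>i\<in>Basis. (u \<bullet> i) *\<^sub>R i) (\<Sum>j\<in>Basis. (v \<bullet> j) *\<^sub>R j)"
    by (simp add: euclidean_representation)
  also have "\<dots> = (\<Sum>i\<in>Basis. \<Sum>j\<in>Basis. ((u \<bullet> i) * (v \<bullet> j)) *\<^sub>R \<beta> i j)"
    unfolding bilinear_sum[OF assms] sum.cartesian_product
    by (simp add: bilinear_lmul[OF assms] bilinear_rmul[OF assms] case_prod_beta mult.commute)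
  finally show ?thesis .
qed

text \<open>Differentiability in x is given only for fixed arguments u, v. Expansion in a basis
  gives a finite sum of scalar coefficients times the functions \<open>B x i j\<close>, to which the
  product rule applies; the sums are then folded back.\<close>

lemma has_derivative_bilinear_field:
  fixes B :: "'v::euclidean_space \<Rightarrow> 'a::euclidean_space \<Rightarrow> 'b::euclidean_space \<Rightarrow> 'c::real_normed_vector"
    and F :: "'d::real_normed_vector \<Rightarrow> 'v"
  assumes "open V" "F y \<in> V" and bil: "\<And>x. x \<in> V \<Longrightarrow> bilinear (B x)"
    and dB: "\<And>u v. (\<lambda>x. B x u v) differentiable (at (F y))"
    and F: "(F has_derivative F') (at y)" and a: "(a has_derivative a') (at y)"
    and c: "(c has_derivative c') (at y)"
  shows "((\<lambda>z. B (F z) (a z) (c z)) has_derivative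
    (\<lambda>h. D (\<lambda>x. B x (a y) (c y)) (F y) (F' h) + B (F y) (a' h) (c y) + B (F y) (a y) (c' h))) (at y)"
proof -
  let ?E = "\<lambda>x u v. \<Sum>i\<in>Basis. \<Sum>j\<in>Basis. ((u \<bullet> i) * (v \<bullet> j)) *\<^sub>R B x i j"
  note dBF = has_derivative_compose[OF F D_works[OF dB]]
  have E: "((\<lambda>z. ?E (F z) (a z) (c z)) has_derivative
    (\<lambda>h. (\<Sum>i\<in>Basis. \<Sum>j\<in>Basis. ((a y \<bullet> i) * (c y \<bullet> j)) *\<^sub>R D (\<lambda>x. B x i j) (F y) (F' h))
       + ?E (F y) (a' h) (c y) + ?E (F y) (a y) (c' h))) (at y)"
  proof -
    have "((\<lambda>z. ((a z \<bullet> i) * (c z \<bullet> j)) *\<^sub>R B (F z) i j) has_derivative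
      (\<lambda>h. ((a y \<bullet> i) * (c y \<bullet> j)) *\<^sub>R D (\<lambda>x. B x i j) (F y) (F' h)
        + ((a y \<bullet> i) * (c' h \<bullet> j) + (a' h \<bullet> i) * (c y \<bullet> j)) *\<^sub>R B (F y) i j)) (at y)" for i j
      by (intro has_derivative_scaleR has_derivative_mult has_derivative_inner_left a c dBF)
    then have "((\<lambda>z. ?E (F z) (a z) (c z)) has_derivative
      (\<lambda>h. \<Sum>i\<in>Basis. \<Sum>j\<in>Basis. ((a y \<bullet> i) * (c y \<bullet> j)) *\<^sub>R D (\<lambda>x. B x i j) (F y) (F' h)
        + ((a y \<bullet> i) * (c' h \<bullet> j) + (a' h \<bullet> i) * (c y \<bullet> j)) *\<^sub>R B (F y) i j)) (at y)"
      by (intro has_derivative_sum)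
    then show ?thesis
      by (simp add: sum.distrib scaleR_add_left add.commute add.left_commute)
  qed
  \<comment> \<open>Bilinearity, and with it the expansion, is available only on V; continuity of F
    keeps nearby points there.\<close>
  have "\<forall>\<^sub>F z in at y. F z \<in> V"
    using has_derivative_continuous[OF F] assms(1,2)
    unfolding continuous_at by (rule topological_tendstoD)
  then obtain W where W: "open W" "y \<in> W" "\<And>z. z \<in> W \<Longrightarrow> F z \<in> V"
    using assms(2) unfolding eventually_at_topological by (metis UNIV_I)
  have 1: "((\<lambda>z. B (F z) (a z) (c z)) has_derivative
    (\<lambda>h. (\<Sum>i\<in>Basis. \<Sum>j\<in>Basis. ((a y \<bullet> i) * (c y \<bullet> j)) *\<^sub>R D (\<lambda>x. B x i j) (F y) (F' h))
       + ?E (F y) (a' h) (c y) + ?E (F y) (a y) (c' h))) (at y)"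
    by (rule has_derivative_transform_within_open[OF E W(1,2)])
      (erule bilinear_expand[OF bil[OF W(3)], symmetric])
  have "D (\<lambda>x. B x (a y) (c y)) (F y) =
     (\<lambda>h. \<Sum>i\<in>Basis. \<Sum>j\<in>Basis. ((a y \<bullet> i) * (c y \<bullet> j)) *\<^sub>R D (\<lambda>x. B x i j) (F y) h)"
  proof (rule D_eq, rule has_derivative_transform_within_open[OF _ assms(1,2)])
    show "((\<lambda>x. ?E x (a y) (c y)) has_derivative (\<lambda>h. \<Sum>i\<in>Basis. \<Sum>j\<in>Basis.
        ((a y \<bullet> i) * (c y \<bullet> j)) *\<^sub>R D (\<lambda>x. B x i j) (F y) h)) (at (F y))"
      by (intro has_derivative_sum has_derivative_scaleR_right D_works dB)
  qed (erule bilinear_expand[OF bil, symmetric])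
  then show ?thesis
    using 1 unfolding bilinear_expand[OF bil[OF assms(2)], symmetric] by simp
qed

section \<open>Riemannian metrics in a chart\<close>

text \<open>Being differentiable and zero at x, r is O(y - x); the factor e tends to 0, so s is o(y
  - x).\<close>

lemma has_derivative_zero_product_bound:
  fixes r :: "'a::real_normed_vector \<Rightarrow> 'b::real_normed_vector" and s :: "'a \<Rightarrow> 'c::real_normed_vector"
  assumes "r differentiable (at x)" "r x = 0" "s x = 0"
    and e: "isCont e x" "e x = 0"
    and d: "d > 0" and s: "\<And>y. norm (y - x) < d \<Longrightarrow> norm (s y) \<le> \<bar>e y\<bar> * norm (r y)"
  shows "(s has_derivative (\<lambda>h. 0)) (at x)"
  unfolding has_derivative_at_alt
proof (intro conjI allI impI)
  obtain r' where r: "(r has_derivative r') (at x)" using assms by (auto simp: differentiable_def)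
  then obtain K where K: "K > 0" "\<And>h. norm (r' h) \<le> norm h * K"
    using bounded_linear.pos_bounded[OF has_derivative_bounded_linear] by blast
  obtain d1 where d1: "d1 > 0" "\<And>y. norm (y - x) < d1 \<Longrightarrow> norm (r y - r x - r' (y - x)) \<le> 1 * norm (y - x)"
    using r zero_less_one unfolding has_derivative_at_alt by blast
  fix \<epsilon> :: real assume "\<epsilon> > 0"
  then have "\<epsilon> / (K + 1) > 0" using K by simp
  then obtain d2 where d2: "d2 > 0" "\<And>y. dist y x < d2 \<Longrightarrow> dist (e y) (e x) < \<epsilon> / (K + 1)"
    using e unfolding continuous_at_eps_delta by metis
  have "norm (s y) \<le> \<epsilon> * norm (y - x)" if y: "norm (y - x) < min d (min d1 d2)" for y
  proof -
    have "norm (r y) \<le> norm (r y - r x - r' (y - x)) + norm (r' (y - x))"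
      using norm_triangle_sub[of "r y" "r' (y - x)"] \<open>r x = 0\<close> by simp
    also have "\<dots> \<le> norm (y - x) + norm (y - x) * K"
      using d1 K y by (intro add_mono) auto
    finally have 1: "norm (r y) \<le> (K + 1) * norm (y - x)" by (simp add: algebra_simps)
    have 2: "\<bar>e y\<bar> \<le> \<epsilon> / (K + 1)" using d2(2)[of y] y e by (simp add: dist_norm)
    have "norm (s y) \<le> \<bar>e y\<bar> * norm (r y)" using s y by simp
    also have "\<dots> \<le> \<epsilon> / (K + 1) * ((K + 1) * norm (y - x))"
      using 1 2 by (intro mult_mono) auto
    also have "\<dots> = \<epsilon> * norm (y - x)" using K by simp
    finally show ?thesis .
  qed
  then show "\<exists>d>0. \<forall>y. norm (y - x) < d \<longrightarrow> norm (s y - s x - 0) \<le> \<epsilon> * norm (y - x)"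
    using d d1 d2 \<open>s x = 0\<close> by (intro exI[of _ "min d (min d1 d2)"]) auto
qed simp

lemma linear_sum_Basis: "linear l \<Longrightarrow> l z = (\<Sum>b\<in>Basis. (z \<bullet> b) *\<^sub>R l b)" for z :: "'a::euclidean_space"
  by (metis (no_types, lifting) euclidean_representation linear_sum linear_cmul sum.cong)

lemma bilinear_D_field:
  fixes B :: "'v::real_normed_vector \<Rightarrow> 'a::real_vector \<Rightarrow> 'b::real_vector \<Rightarrow> 'c::real_normed_vector"
  assumes V: "open V" "x \<in> V" and bil: "\<And>x. x \<in> V \<Longrightarrow> bilinear (B x)"
    and d: "\<And>u v. (\<lambda>y. B y u v) differentiable (at x)"
  shows "bilinear (\<lambda>u v. D (\<lambda>y. B y u v) x w)"
proof -
  have tr: "D (\<lambda>y. B y u v) x = D f x" if "\<And>y. y \<in> V \<Longrightarrow> B y u v = f y" for f u v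
    using frechet_derivative_transform_within_open[OF d V] that by simp
  note ad = D_eq[OF has_derivative_add[OF D_works[OF d] D_works[OF d]]]
  note sc = D_eq[OF has_derivative_scaleR_right[OF D_works[OF d]]]
  show ?thesis
    unfolding bilinear_def linear_iff
  proof (intro allI conjI)
    fix u u' v v' c
    have "D (\<lambda>y. B y (u + u') v) x w = D (\<lambda>y. B y u v + B y u' v) x w"
      by (subst tr[of "u + u'"]) (auto simp: bilinear_ladd[OF bil])
    then show "D (\<lambda>y. B y (u + u') v) x w = D (\<lambda>y. B y u v) x w + D (\<lambda>y. B y u' v) x w"
      by (simp only: ad)
    have "D (\<lambda>y. B y (c *\<^sub>R u) v) x w = D (\<lambda>y. c *\<^sub>R B y u v) x w"
      by (subst tr[of "c *\<^sub>R u"]) (auto simp: bilinear_lmul[OF bil])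
    then show "D (\<lambda>y. B y (c *\<^sub>R u) v) x w = c *\<^sub>R D (\<lambda>y. B y u v) x w"
      by (simp only: sc)
    have "D (\<lambda>y. B y u (v + v')) x w = D (\<lambda>y. B y u v + B y u v') x w"
      by (subst tr[of _ "v + v'"]) (auto simp: bilinear_radd[OF bil])
    then show "D (\<lambda>y. B y u (v + v')) x w = D (\<lambda>y. B y u v) x w + D (\<lambda>y. B y u v') x w"
      by (simp only: ad)
    have "D (\<lambda>y. B y u (c *\<^sub>R v)) x w = D (\<lambda>y. c *\<^sub>R B y u v) x w"
      by (subst tr[of _ "c *\<^sub>R v"]) (auto simp: bilinear_rmul[OF bil])
    then show "D (\<lambda>y. B y u (c *\<^sub>R v)) x w = c *\<^sub>R D (\<lambda>y. B y u v) x w"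
      by (simp only: sc)
  qed
qed

text \<open>V plays the image of a chart. Smoothness is demanded for fixed u, v, the form in which
  \<open>riemannian_manifold\<close> supplies it.\<close>

locale metric_field =
  fixes g :: "'a::euclidean_space local_metric" and V :: "'a set"
  assumes open_V: "open V"
    and bilinear_g: "x \<in> V \<Longrightarrow> bilinear (g x)"
    and sym_g: "x \<in> V \<Longrightarrow> g x u v = g x v u"
    and pos_g: "x \<in> V \<Longrightarrow> u \<noteq> 0 \<Longrightarrow> 0 < g x u u"
    and smooth_g: "smooth_on (\<lambda>x. g x u v) V"
begin

lemma g_simps:
  assumes "x \<in> V"
  shows "g x (u + u') v = g x u v + g x u' v" "g x u (v + v') = g x u v + g x u v'"
    "g x (u - u') v = g x u v - g x u' v" "g x u (v - v') = g x u v - g x u v'"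
    "g x (a *\<^sub>R u) v = a * g x u v" "g x u (a *\<^sub>R v) = a * g x u v"
    "g x (- u) v = - g x u v" "g x u (- v) = - g x u v" "g x 0 v = 0" "g x u 0 = 0"
  using bilinear_g[OF assms]
  by (simp_all add: bilinear_ladd bilinear_radd bilinear_lsub bilinear_rsub bilinear_lmul bilinear_rmul
      bilinear_lneg bilinear_rneg bilinear_lzero bilinear_rzero)

lemma linear_g: "x \<in> V \<Longrightarrow> linear (g x u)" "x \<in> V \<Longrightarrow> linear (\<lambda>u. g x u v)"
  using bilinear_g by (auto simp: bilinear_def)

lemma g_eqI: "x \<in> V \<Longrightarrow> (\<And>z. g x u z = g x v z) \<Longrightarrow> u = v"
  using pos_g[of x "u - v"] by (auto simp: g_simps)

lemma g_diff: "x \<in> V \<Longrightarrow> (\<lambda>y. g y u v) differentiable (at x)"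
  by (rule smooth_on_differentiable[OF smooth_g])

text \<open>\<open>G w\<close> represents \<open>g x w\<close> with respect to the Euclidean inner
  product. Positivity makes G injective, hence surjective in finite dimension. This is the existence
  half of the \<open>THE\<close> in \<open>christoffel\<close>.\<close>

lemma riesz:
  assumes x: "x \<in> V" and l: "linear l"
  shows "\<exists>w. \<forall>z. g x w z = l z"
proof -
  define G where "G w = (\<Sum>b\<in>Basis. g x w b *\<^sub>R b)" for w
  have G: "G w \<bullet> z = g x w z" for w z
    using linear_sum_Basis[OF linear_g(1)[OF x], of w z] unfolding G_def
    by (simp add: inner_sum_left inner_commute[of z] mult.commute)
  have "linear G"
    unfolding G_def by (intro linearI) (simp_all add: g_simps[OF x] scaleR_add_left sum.distrib scaleR_sum_right)
  moreover have "inj G"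
    using G g_eqI[OF x] by (metis injI)
  ultimately have "surj G" by (rule linear_inj_imp_surj)
  then obtain w where "G w = (\<Sum>b\<in>Basis. l b *\<^sub>R b)" by (metis surjD)
  then have "g x w z = l z" for z
    using linear_sum_Basis[OF l, of z] G[of w z]
    by (simp add: inner_sum_left inner_commute[of z] mult.commute)
  then show ?thesis by blast
qed

text \<open>Writing \<open>g x = g x\<^sub>0 + (g x - g x\<^sub>0)\<close>, the solution satisfies
  \<open>w x - w x\<^sub>0 = r x - s x\<close> with \<open>r\<close> differentiable and \<open>s x = o(x - x\<^sub>0)\<close>.\<close>

lemma differentiable_solution:
  assumes x0: "x0 \<in> V" and w: "\<And>x z. x \<in> V \<Longrightarrow> g x (w x) z = k x z"
    and k: "\<And>z. (\<lambda>x. k x z) differentiable (at x0)"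
  shows "w differentiable (at x0)"
proof -
  \<comment> \<open>\<open>a b\<close> represents the functional b \<bullet> z with respect to
    \<open>g x0\<close>, so A inverts the metric at x0 on linear functionals.\<close>
  define a where "a b = (SOME w. \<forall>z. g x0 w z = b \<bullet> z)" for b
  have a: "g x0 (a b) z = b \<bullet> z" for b z
  proof -
    have "\<forall>z. g x0 (a b) z = b \<bullet> z"
      unfolding a_def by (rule someI_ex, rule riesz[OF x0]) (simp add: linear_iff inner_add_right)
    then show ?thesis by blast
  qed
  define A where "A l = (\<Sum>b\<in>Basis. l b *\<^sub>R a b)" for l
  have A: "g x0 (A l) z = l z" if "linear l" for l z
    using linear_sum_Basis[OF that, of z] unfolding A_def linear_sum[OF linear_g(2)[OF x0]]
    by (simp add: g_simps[OF x0] a inner_commute mult.commute)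
  define r where "r x = A (\<lambda>z. k x z - g x (w x0) z)" for x
  \<comment> \<open>\<open>E x\<close> is the endomorphism that \<open>g x - g x0\<close> becomes
    under the metric at x0; \<open>e\<close> below bounds its norm and tends to 0.\<close>
  define E where "E x v = A (\<lambda>z. g x v z - g x0 v z)" for x v
  define s where "s x = E x (w x - w x0)" for x
  have lin: "linear (\<lambda>z. g x v z - g x0 v z)" "linear (\<lambda>z. k x z - g x (w x0) z)" if "x \<in> V" for x v
    unfolding w[OF that, symmetric] using that x0
    by (auto simp: g_simps algebra_simps intro!: linearI)
  have eq: "w x = w x0 + r x - s x" if x: "x \<in> V" for x
  proof (rule g_eqI[OF x0])
    fix z
    have "g x0 (r x) z = k x z - g x (w x0) z" unfolding r_def by (rule A[OF lin(2)[OF x]])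
    moreover have "g x0 (s x) z = g x (w x - w x0) z - g x0 (w x - w x0) z"
      unfolding s_def E_def by (rule A[OF lin(1)[OF x]])
    ultimately show "g x0 (w x) z = g x0 (w x0 + r x - s x) z"
      by (simp add: g_simps x x0 w)
  qed
  define e where "e x = (\<Sum>i\<in>Basis. norm (E x i))" for x
  have E_lin: "E x (v + v') = E x v + E x v'" "E x (c *\<^sub>R v) = c *\<^sub>R E x v" if "x \<in> V" for x v v' c
    unfolding E_def A_def using that x0
    by (simp_all add: g_simps scaleR_sum_right algebra_simps flip: sum.distrib sum_subtractf)
  have E_bound: "norm (E x v) \<le> e x * norm v" if "x \<in> V" for x v
  proof -
    have "norm (E x v) \<le> (\<Sum>i\<in>Basis. norm ((v \<bullet> i) *\<^sub>R E x i))"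
      using linear_sum_Basis[of "E x" v] E_lin[OF that] norm_sum[of "\<lambda>i. (v \<bullet> i) *\<^sub>R E x i" Basis]
      by (simp add: linear_iff)
    also have "\<dots> \<le> (\<Sum>i\<in>Basis. norm v * norm (E x i))"
      by (intro sum_mono) (simp add: Basis_le_norm mult_right_mono)
    finally show ?thesis by (simp add: e_def sum_distrib_left mult.commute)
  qed
  have e_nonneg: "e x \<ge> 0" for x by (simp add: e_def sum_nonneg)
  have "r differentiable (at x0)"
    unfolding r_def A_def
    by (intro differentiable_sum ballI differentiable_scaleR differentiable_diff k g_diff x0) auto
  moreover have r0: "r x0 = 0" by (simp add: r_def A_def w x0)
  moreover have "s x0 = 0" by (simp add: s_def E_def A_def)
  moreover have cont: "isCont e x0"
  proof -
    have "isCont (\<lambda>x. g x u v) x0" for u v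
      using g_diff[OF x0] by (rule differentiable_imp_continuous_within)
    then show ?thesis unfolding e_def E_def A_def by (intro continuous_intros) auto
  qed
  then have "isCont (\<lambda>x. 2 * e x) x0" by (intro continuous_intros)
  moreover have e0: "2 * e x0 = 0" by (simp add: e_def E_def A_def)
  \<comment> \<open>Not even continuity of w at x0 is known here. Where \<open>e x\<close> is at
    most 1/2, the term s can be absorbed: |w x - w x0| \<le> |r x| + |w x - w x0| / 2 gives |w x - w
    x0| \<le> 2 |r x|, hence the factor 2.\<close>
  moreover obtain d where "d > 0" "\<And>x. norm (x - x0) < d \<Longrightarrow> norm (s x) \<le> \<bar>2 * e x\<bar> * norm (r x)"
  proof -
    obtain d1 where d1: "d1 > 0" "\<And>x. dist x x0 < d1 \<Longrightarrow> x \<in> V"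
      using open_V x0 unfolding open_dist by metis
    obtain d2 where d2: "d2 > 0" "\<And>x. dist x x0 < d2 \<Longrightarrow> dist (e x) (e x0) < 1 / 2"
      using cont unfolding continuous_at_eps_delta by (metis half_gt_zero_iff zero_less_one)
    have "norm (s x) \<le> \<bar>2 * e x\<bar> * norm (r x)" if n: "norm (x - x0) < min d1 d2" for x
    proof -
      have x: "x \<in> V" using d1 n by (simp add: dist_norm)
      have e: "e x \<le> 1 / 2" using d2(2)[of x] n e0 by (simp add: dist_norm)
      have s: "norm (s x) \<le> e x * norm (w x - w x0)" unfolding s_def by (rule E_bound[OF x])
      have "norm (w x - w x0) \<le> norm (r x) + norm (s x)"
        using norm_triangle_ineq4[of "r x" "s x"] by (subst eq[OF x]) simp
      also have "\<dots> \<le> norm (r x) + 1 / 2 * norm (w x - w x0)"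
        using s mult_right_mono[OF e norm_ge_zero[of "w x - w x0"]] by linarith
      finally have "norm (w x - w x0) \<le> 2 * norm (r x)" by simp
      from mult_left_mono[OF this e_nonneg[of x]] show ?thesis using s e_nonneg[of x] by simp
    qed
    then show ?thesis using that[of "min d1 d2"] d1 d2 by auto
  qed
  ultimately have "(s has_derivative (\<lambda>h. 0)) (at x0)"
    by (rule has_derivative_zero_product_bound)
  then have "((\<lambda>x. w x0 + r x - s x) has_derivative (\<lambda>h. 0 + D r x0 h - 0)) (at x0)"
    by (intro has_derivative_diff has_derivative_add has_derivative_const D_works \<open>r differentiable (at x0)\<close>)
  from has_derivative_transform_within_open[OF this open_V x0] eq
  show ?thesis unfolding differentiable_def by (metis (no_types, lifting))
qed

lemma dmetric_lin:
  assumes "x \<in> V"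
  shows "linear (\<lambda>w. dmetric g x w u v)" "linear (\<lambda>u. dmetric g x w u v)" "linear (\<lambda>v. dmetric g x w u v)"
  using linear_frechet_derivative[OF g_diff[OF assms]]
    bilinear_D_field[OF open_V assms bilinear_g g_diff[OF assms]]
  by (auto simp: dmetric_def bilinear_def)

lemma dmetric_sym: "x \<in> V \<Longrightarrow> dmetric g x w u v = dmetric g x w v u"
  unfolding dmetric_def
  using frechet_derivative_transform_within_open[OF g_diff open_V, of x u v "\<lambda>y. g y v u"] sym_g
  by metis

section \<open>The Levi-Civita connection in coordinates\<close>

abbreviation "\<Gamma> \<equiv> christoffel g"

text \<open>Discharges the \<open>THE\<close> in \<open>christoffel\<close>: the right-hand side is
  linear in z, so \<open>riesz\<close> gives a solution, and nondegeneracy makes it unique.\<close>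

lemma koszul:
  assumes x: "x \<in> V"
  shows "2 * g x (\<Gamma> x u v) z = dmetric g x u v z + dmetric g x v u z - dmetric g x z u v"
proof -
  let ?l = "\<lambda>z. (dmetric g x u v z + dmetric g x v u z - dmetric g x z u v) / 2"
  have "linear ?l"
    using dmetric_lin[OF x] by (auto simp: linear_iff add_divide_distrib diff_divide_distrib algebra_simps)
  from riesz[OF x this] obtain w where "\<forall>z. g x w z = ?l z" by blast
  from spec[OF this] have w: "2 * g x w z = dmetric g x u v z + dmetric g x v u z - dmetric g x z u v" for z
    by (simp add: field_simps)
  have "\<forall>z. 2 * g x (\<Gamma> x u v) z = dmetric g x u v z + dmetric g x v u z - dmetric g x z u v"
    unfolding christoffel_def
    by (rule theI[of _ w]) (use w in \<open>auto intro!: g_eqI[OF x]\<close>, metis mult_cancel_left zero_neq_numeral)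
  then show ?thesis by blast
qed

lemma christoffel_sym: "x \<in> V \<Longrightarrow> \<Gamma> x u v = \<Gamma> x v u"
  by (rule g_eqI) (use koszul[of x u v] koszul[of x v u] dmetric_sym in auto, smt (verit))

lemma christoffel_linear_right:
  assumes x: "x \<in> V"
  shows "linear (\<Gamma> x u)"
proof (rule linearI)
  note l = dmetric_lin[OF x, THEN linear_add] dmetric_lin[OF x, THEN linear_cmul]
  fix v v' c
  show "\<Gamma> x u (v + v') = \<Gamma> x u v + \<Gamma> x u v'"
  proof (rule g_eqI[OF x])
    fix z show "g x (\<Gamma> x u (v + v')) z = g x (\<Gamma> x u v + \<Gamma> x u v') z"
      using koszul[OF x, of u "v + v'" z] koszul[OF x, of u v z] koszul[OF x, of u v' z]
      by (simp add: l g_simps[OF x])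
  qed
  show "\<Gamma> x u (c *\<^sub>R v) = c *\<^sub>R \<Gamma> x u v"
  proof (rule g_eqI[OF x])
    fix z show "g x (\<Gamma> x u (c *\<^sub>R v)) z = g x (c *\<^sub>R \<Gamma> x u v) z"
      using koszul[OF x, of u "c *\<^sub>R v" z] arg_cong[OF koszul[OF x, of u v z], of "\<lambda>t. c * t"]
      by (simp add: l g_simps[OF x] algebra_simps)
  qed
qed

lemma bilinear_christoffel: "x \<in> V \<Longrightarrow> bilinear (\<Gamma> x)"
  unfolding bilinear_def using christoffel_linear_right christoffel_sym
  by (metis (no_types, lifting) ext)

text \<open>Metric compatibility: in the sum of the Koszul identities for (w, u, v) and (w, v, u)
  only the derivative along w survives.\<close>

lemma compat:
  "x \<in> V \<Longrightarrow> dmetric g x w u v = g x (\<Gamma> x w u) v + g x u (\<Gamma> x w v)"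
  using koszul[of x w u v] koszul[of x w v u] sym_g[of x u "\<Gamma> x w v"] dmetric_sym[of x w u v]
    dmetric_sym[of x v w u] dmetric_sym[of x u w v] by simp

lemma christoffel_differentiable:
  assumes "x \<in> V"
  shows "(\<lambda>y. \<Gamma> y u v) differentiable (at x)"
proof (rule differentiable_solution[OF assms])
  show "g y (\<Gamma> y u v) z = (1 / 2) *\<^sub>R (dmetric g y u v z + dmetric g y v u z - dmetric g y z u v)"
    if "y \<in> V" for y z using koszul[OF that, of u v z] by simp
  have "(\<lambda>y. dmetric g y w u v) differentiable (at x)" for w u v
    unfolding dmetric_def by (rule smooth_on_differentiable[OF smooth_on_D[OF smooth_g] assms])
  then show "(\<lambda>y. (1 / 2) *\<^sub>R (dmetric g y u v z + dmetric g y v u z - dmetric g y z u v)) differentiable (at x)" for z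
    by (intro differentiable_scaleR differentiable_add differentiable_diff differentiable_const)
qed

end

context metric_field
begin

lemma christoffel_simps:
  assumes "x \<in> V"
  shows "\<Gamma> x (u + u') v = \<Gamma> x u v + \<Gamma> x u' v" "\<Gamma> x u (v + v') = \<Gamma> x u v + \<Gamma> x u v'"
    "\<Gamma> x (a *\<^sub>R u) v = a *\<^sub>R \<Gamma> x u v" "\<Gamma> x u (a *\<^sub>R v) = a *\<^sub>R \<Gamma> x u v"
    "\<Gamma> x 0 v = 0" "\<Gamma> x u 0 = 0"
  using bilinear_christoffel[OF assms]
  by (simp_all add: bilinear_ladd bilinear_radd bilinear_lmul bilinear_rmul bilinear_lzero bilinear_rzero)

lemma has_derivative_christoffel_along:
  assumes "F y \<in> V" "(F has_derivative F') (at y)" "(a has_derivative a') (at y)" "(c has_derivative c') (at y)"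
  shows "((\<lambda>z. \<Gamma> (F z) (a z) (c z)) has_derivative
    (\<lambda>h. D (\<lambda>x. \<Gamma> x (a y) (c y)) (F y) (F' h) + \<Gamma> (F y) (a' h) (c y) + \<Gamma> (F y) (a y) (c' h))) (at y)"
  by (rule has_derivative_bilinear_field[OF open_V assms(1) bilinear_christoffel
        christoffel_differentiable[OF assms(1)] assms(2-)])

text \<open>The Leibniz rule for covariant derivatives along F:
  \<open>a' h + \<Gamma> (F y) (F' h) (a y)\<close> is the covariant derivative of the field a, and
  \<open>compat\<close> absorbs the derivative of the metric into the connection terms.\<close>

lemma has_derivative_g_along:
  assumes "F y \<in> V" "(F has_derivative F') (at y)" "(a has_derivative a') (at y)" "(c has_derivative c') (at y)"
  shows "((\<lambda>z. g (F z) (a z) (c z)) has_derivative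
    (\<lambda>h. g (F y) (a' h + \<Gamma> (F y) (F' h) (a y)) (c y) + g (F y) (a y) (c' h + \<Gamma> (F y) (F' h) (c y)))) (at y)"
proof -
  have eq: "D (\<lambda>x. g x (a y) (c y)) (F y) (F' h) + g (F y) (a' h) (c y) + g (F y) (a y) (c' h) =
    g (F y) (a' h + \<Gamma> (F y) (F' h) (a y)) (c y) + g (F y) (a y) (c' h + \<Gamma> (F y) (F' h) (c y))" for h
    using compat[OF assms(1), of "F' h" "a y" "c y"] by (simp add: dmetric_def g_simps assms(1))
  show ?thesis
    using has_derivative_bilinear_field[OF open_V assms(1) bilinear_g g_diff[OF assms(1)] assms(2-)]
    unfolding eq .
qed

section \<open>Symmetries of the curvature tensor\<close>

abbreviation "R \<equiv> curvature g"

lemma bilinear_D_christoffel: "x \<in> V \<Longrightarrow> bilinear (\<lambda>u v. D (\<lambda>y. \<Gamma> y u v) x w)"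
  by (rule bilinear_D_field[OF open_V _ bilinear_christoffel christoffel_differentiable])

lemma D_christoffel_sym: "x \<in> V \<Longrightarrow> D (\<lambda>y. \<Gamma> y u v) x = D (\<lambda>y. \<Gamma> y v u) x"
  by (rule frechet_derivative_transform_within_open[OF christoffel_differentiable open_V])
    (auto intro: christoffel_sym)

lemma curvature_anti12: "R x u v w = - R x v u w"
  by (simp add: curvature_def)

lemma linear_curvature1: "x \<in> V \<Longrightarrow> linear (\<lambda>u. R x u v w)"
  using linear_frechet_derivative[OF christoffel_differentiable, of x v w] bilinear_D_christoffel[of x v]
  by (auto simp: linear_iff bilinear_def curvature_def christoffel_simps algebra_simps)

lemma bianchi: "x \<in> V \<Longrightarrow> R x u v w + R x v w u + R x w u v = 0"
  unfolding curvature_def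
  using D_christoffel_sym[of x u v] D_christoffel_sym[of x v w] D_christoffel_sym[of x w u]
    christoffel_sym[of x u v] christoffel_sym[of x v w] christoffel_sym[of x w u]
  by simp

text \<open>Metric compatibility, used twice, expands the second derivative of
  \<open>g y w z\<close>. Antisymmetrizing in u, v kills this derivative and the products of two
  first covariant derivatives, leaving g(R w, z) + g(w, R z) = 0.\<close>

lemma curvature_anti34:
  assumes x: "x \<in> V"
  shows "g x (R x u v w) z = - g x (R x u v z) w"
proof -
  have d: "D (\<lambda>y. D (\<lambda>y. g y w z) y v) x u =
      g x (D (\<lambda>y. \<Gamma> y v w) x u + \<Gamma> x u (\<Gamma> x v w)) z + g x (\<Gamma> x v w) (\<Gamma> x u z)
      + (g x (\<Gamma> x u w) (\<Gamma> x v z) + g x w (D (\<lambda>y. \<Gamma> y v z) x u + \<Gamma> x u (\<Gamma> x v z)))" for u v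
  proof -
    have tr: "D (\<lambda>y. D (\<lambda>y. g y w z) y v) x = D (\<lambda>y. g y (\<Gamma> y v w) z + g y w (\<Gamma> y v z)) x"
      by (rule frechet_derivative_transform_within_open[OF
            smooth_on_differentiable[OF smooth_on_D[OF smooth_g] x] open_V x])
        (simp add: compat[unfolded dmetric_def])
    note G = D_works[OF christoffel_differentiable[OF x]]
    note id = has_derivative_ident
    have "((\<lambda>y. g y (\<Gamma> y v w) z + g y w (\<Gamma> y v z)) has_derivative (\<lambda>u.
        (g x (D (\<lambda>y. \<Gamma> y v w) x u + \<Gamma> x u (\<Gamma> x v w)) z + g x (\<Gamma> x v w) (0 + \<Gamma> x u z))
      + (g x (0 + \<Gamma> x u w) (\<Gamma> x v z) + g x w (D (\<lambda>y. \<Gamma> y v z) x u + \<Gamma> x u (\<Gamma> x v z))))) (at x)"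
      by (intro has_derivative_add has_derivative_g_along[where F = "\<lambda>y. y"] x id G has_derivative_const)
    from D_eq[OF this] show ?thesis unfolding tr by simp
  qed
  have "D (\<lambda>y. D (\<lambda>y. g y w z) y v) x u = D (\<lambda>y. D (\<lambda>y. g y w z) y u) x v"
    by (rule second_derivative_symmetric[OF open_V x smooth_g])
  then have "g x (R x u v w) z + g x w (R x u v z) = 0"
    unfolding d by (simp add: curvature_def g_simps[OF x] algebra_simps)
  then show ?thesis using sym_g[OF x, of w "R x u v z"] by simp
qed

end

section \<open>Algebra of curvature tensors\<close>

lemma curvature_pair_symmetry:
  fixes R :: "'a \<Rightarrow> 'a \<Rightarrow> 'a \<Rightarrow> 'a \<Rightarrow> real"
  assumes a12: "\<And>u v w z. R u v w z = - R v u w z" and a34: "\<And>u v w z. R u v w z = - R u v z w"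
    and b: "\<And>u v w z. R u v w z + R v w u z + R w u v z = 0"
  shows "R u v w z = R w z u v"
  \<comment> \<open>Bianchi's identity with each of the four vectors in turn as the fixed last
    argument; in a signed combination, antisymmetry cancels all terms but those of the two
    sides.\<close>
  using b[of u v w z] b[of v w z u] b[of w z u v] b[of z u v w]
    a12[of v w u z] a12[of w u v z] a12[of w z v u] a12[of v z w u] a12[of z u w v] a12[of z v u w] a12[of u w z v]
    a34[of v w u z] a34[of w u v z] a34[of w z v u] a34[of z v w u] a34[of z u w v] a34[of u w z v]
    a34[of u v z w] a34[of v z w u] a34[of u v w z] a34[of z v u w]  a12[of u z v w] a12[of u v w z] a12[of u v z w]
    a34[of v w z u] a34[of w z u v] a34[of u z v w] a12[of z w u v] a12[of z w v u] a12[of v w z u]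
  by linarith

text \<open>Besides Q X and Q Y, the part of Q (X + Y) even in Y involves only the curvatures on X,
  Y and on X, J Y, with weights 4 and 12 in fact \<open>S\<close>. Replacing Y by J Y exchanges the
  weights; three times the new identity minus the old one eliminates the second curvature and leaves
  3 * 12 - 4 = 32.\<close>

lemma kaehler_polarization:
  fixes R :: "'a::real_vector \<Rightarrow> 'a \<Rightarrow> 'a \<Rightarrow> 'a \<Rightarrow> real"
    and J :: "'a \<Rightarrow> 'a"
  assumes lin: "\<And>v w z. linear (\<lambda>u. R u v w z)"
    and a12: "\<And>u v w z. R u v w z = - R v u w z" and a34: "\<And>u v w z. R u v w z = - R u v z w"
    and b: "\<And>u v w z. R u v w z + R v w u z + R w u v z = 0"
    and J: "linear J" "\<And>u. J (J u) = - u" and JR: "\<And>u v w z. R u v (J w) (J z) = R u v w z"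
  defines "Q \<equiv> \<lambda>u. R u (J u) (J u) u"
  shows "32 * R X Y Y X = 3 * Q (X + J Y) + 3 * Q (X - J Y) - Q (X + Y) - Q (X - Y) - 4 * Q X - 4 * Q Y"
proof -
  note p = curvature_pair_symmetry[of R, OF a12 a34 b]
  have 1: "R (u + u') v w z = R u v w z + R u' v w z" "R (- u) v w z = - R u v w z"
    "R (u - u') v w z = R u v w z - R u' v w z" for u u' v w z
    using linear_add[OF lin] linear_neg[OF lin] linear_diff[OF lin] by auto
  have 2: "R v (u + u') w z = R v u w z + R v u' w z" "R v (- u) w z = - R v u w z"
    "R v (u - u') w z = R v u w z - R v u' w z" for u u' v w z
    using 1 a12[of v] by simp_all
  have 3: "R v w (u + u') z = R v w u z + R v w u' z" "R v w (- u) z = - R v w u z"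
    "R v w (u - u') z = R v w u z - R v w u' z" for u u' v w z
    using 1 p by metis+
  have 4: "R v w z (u + u') = R v w z u + R v w z u'" "R v w z (- u) = - R v w z u"
    "R v w z (u - u') = R v w z u - R v w z u'" for u u' v w z
    using 2 p by metis+
  note lins = 1 2 3 4 linear_add[OF J(1)] linear_neg[OF J(1)] linear_diff[OF J(1)] J(2)
  have J1: "R (J u) (J v) w z = R u v w z" for u v w z using JR p by metis
  have Ja: "R u v (J w) z = - R u v w (J z)" for u v w z using JR[of u v w "J z"] by (simp add: lins)
  have Jb: "R (J u) v w z = - R u (J v) w z" for u v w z using J1[of u "J v" w z] by (simp add: lins)
  \<comment> \<open>Six terms with two X and two Y survive. Four equal
    \<open>R X (J Y) (J Y) X\<close>; by Bianchi the other two are each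
    \<open>R X Y Y X + R X (J Y) (J Y) X\<close>. Both signs of Y contribute alike, whence 2 * 2 = 4
    and 2 * 6 = 12.\<close>
  have S: "Q (X + Y) + Q (X - Y) = 2 * Q X + 2 * Q Y + 4 * R X Y Y X + 12 * R X (J Y) (J Y) X" for X Y
  proof -
    have t1: "R Y (J X) (J X) Y = R X (J Y) (J Y) X" using p Jb a12 Ja by (metis (no_types) J1 JR)
    have t2: "R X (J Y) (J X) Y = R X (J Y) (J Y) X" using Ja a34 by metis
    have t3: "R Y (J X) (J Y) X = R X (J Y) (J Y) X" using t1 Ja a34 by metis
    have t4: "R X (J X) (J Y) Y = R X Y Y X + R X (J Y) (J Y) X"
      using b[of X "J X" "J Y" Y] J1[of X Y X Y] a34[of X Y X Y] a12[of "J Y" X "J X" Y] t2 by simp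
    have t5: "R Y (J Y) (J X) X = R X Y Y X + R X (J Y) (J Y) X"
      using b[of Y "J Y" "J X" X] J1[of Y X Y X] a34[of Y X Y X] a12[of "J X" Y "J Y" X] a12[of Y X X Y]
        a34[of X Y Y X] a12[of X Y Y X] t3 by simp
    show ?thesis unfolding Q_def by (simp add: lins t1 t2 t3 t4 t5)
  qed
  have "Q (J Y) = Q Y" by (simp only: Q_def J1 JR)
  moreover have "R X (J (J Y)) (J (J Y)) X = R X Y Y X" by (simp add: lins)
  ultimately show ?thesis using S[of X "J Y"] S[of X Y] by linarith
qed

section \<open>Kaehler metrics\<close>

lemma linear_J: "linear J"
  by (rule linearI) (simp_all add: J_def vec_eq_iff algebra_simps)

lemma J_J: "J (J v) = - v"
  by (simp add: J_def vec_eq_iff)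

locale kaehler_field = metric_field g V for g :: "(complex^'m) local_metric" and V +
  assumes J_inv: "x \<in> V \<Longrightarrow> g x (J u) (J v) = g x u v"
    and kaehler_closed: "x \<in> V \<Longrightarrow>
      dmetric g x u (J v) w + dmetric g x v (J w) u + dmetric g x w (J u) v = 0"
begin

lemma g_J: "x \<in> V \<Longrightarrow> g x (J u) v = - g x u (J v)"
  using J_inv[of x u "J v"] by (simp add: J_J g_simps)

lemma dmetric_J: "x \<in> V \<Longrightarrow> dmetric g x w (J u) v = - dmetric g x w u (J v)"
proof -
  assume x: "x \<in> V"
  have "dmetric g x w (J u) (J (J v)) = dmetric g x w u (J v)"
    unfolding dmetric_def
    by (subst frechet_derivative_transform_within_open[OF g_diff[OF x] open_V x]) (auto simp: J_inv)
  then show ?thesis using linear_neg[OF dmetric_lin(3)[OF x]] by (simp add: J_J)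
qed

text \<open>J is parallel; its components are constant in the chart, so this concerns the
  Christoffel symbols alone. The Koszul formulas for g(\<Gamma> u (J v), z) and g(\<Gamma> u v, J z)
  add up, with signs, to the closedness of the Kaehler form at (u, v, z) and (u, J v, J z).\<close>

lemma christoffel_J:
  assumes x: "x \<in> V"
  shows "\<Gamma> x u (J v) = J (\<Gamma> x u v)"
proof (rule g_eqI[OF x])
  fix z
  note neg = linear_neg[OF dmetric_lin(2)[OF x]] linear_neg[OF dmetric_lin(3)[OF x]]
  have "dmetric g x u (J v) z + dmetric g x v (J z) u - dmetric g x z u (J v) = 0"
    using kaehler_closed[OF x, of u v z] dmetric_J[OF x, of z u v] by simp
  moreover have "dmetric g x u v (J z) + dmetric g x (J v) z u - dmetric g x (J z) u v = 0"
    using kaehler_closed[OF x, of u "J v" "J z"] dmetric_J[OF x, of "J z" u "J v"]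
    by (simp add: J_J neg)
  moreover have "dmetric g x v (J z) u = dmetric g x v u (J z)" "dmetric g x (J v) z u = dmetric g x (J v) u z"
    by (rule dmetric_sym[OF x])+
  ultimately have "2 * g x (\<Gamma> x u (J v)) z + 2 * g x (\<Gamma> x u v) (J z) = 0"
    using koszul[OF x, of u "J v" z] koszul[OF x, of u v "J z"] by linarith
  then show "g x (\<Gamma> x u (J v)) z = g x (J (\<Gamma> x u v)) z"
    by (simp add: g_J[OF x])
qed

lemma curvature_J:
  assumes x: "x \<in> V"
  shows "R x u v (J w) = J (R x u v w)"
proof -
  have "D (\<lambda>y. \<Gamma> y v (J w)) x u = J (D (\<lambda>y. \<Gamma> y v w) x u)" for u v
  proof -
    have "D (\<lambda>y. \<Gamma> y v (J w)) x = D (\<lambda>y. J (\<Gamma> y v w)) x"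
      by (rule frechet_derivative_transform_within_open[OF christoffel_differentiable[OF x] open_V x])
        (simp add: christoffel_J)
    then show ?thesis
      using D_bounded_linear_comp[OF linear_conv_bounded_linear[THEN iffD1, OF linear_J]
          christoffel_differentiable[OF x]] by simp
  qed
  then show ?thesis
    by (simp add: curvature_def christoffel_J[OF x] linear_add[OF linear_J] linear_diff[OF linear_J])
qed

text \<open>Since g(X, J Y) = 0, both X + J Y and X - J Y have squared length |X|^2 + |Y|^2, whereas
  X + Y and X - Y together contribute an extra 8 g(X, Y)^2 to the fourth powers of length.
  Polarization with Q u = 4 c |u|^4 then leaves 32 c times the Gram determinant.\<close>

lemma curvature_totally_real:
  assumes x: "x \<in> V" and hol: "\<And>u. g x (R x u (J u) (J u)) u = 4 * c * (g x u u)\<^sup>2"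
    and tr: "g x (J X) Y = 0"
  shows "g x (R x X Y Y) X = c * (g x X X * g x Y Y - (g x X Y)\<^sup>2)"
proof -
  let ?Q = "\<lambda>u. g x (R x u (J u) (J u)) u"
  have XJ: "g x X (J Y) = 0" "g x (J Y) X = 0"
    using tr g_J[OF x, of X Y] sym_g[OF x] by auto
  have "32 * g x (R x X Y Y) X = 3 * ?Q (X + J Y) + 3 * ?Q (X - J Y) - ?Q (X + Y) - ?Q (X - Y) - 4 * ?Q X - 4 * ?Q Y"
  proof (rule kaehler_polarization[of "\<lambda>u v w z. g x (R x u v w) z" J])
    show "linear (\<lambda>u. g x (R x u v w) z)" for v w z
      using linear_compose[OF linear_curvature1[OF x] linear_g(2)[OF x]] by (simp add: o_def)
    show "g x (R x u v w) z = - g x (R x v u w) z" for u v w z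
      by (subst curvature_anti12) (simp add: g_simps[OF x])
    show "g x (R x u v w) z + g x (R x v w u) z + g x (R x w u v) z = 0" for u v w z
      using arg_cong[OF bianchi[OF x, of u v w], of "\<lambda>t. g x t z"] by (simp add: g_simps[OF x])
  qed (rule curvature_anti34[OF x], simp_all add: linear_J J_J curvature_J x J_inv)
  also have "\<dots> = 32 * (c * (g x X X * g x Y Y - (g x X Y)\<^sup>2))"
    unfolding hol using XJ sym_g[OF x, of Y X]
    by (simp add: g_simps[OF x] J_inv[OF x] power2_eq_square algebra_simps)
  finally show ?thesis by simp
qed

end

section \<open>The Gauss equation\<close>

text \<open>W plays the part of the chart of M that F maps into the chart V. The isometry identity
  is required on all of W because it will be differentiated.\<close>

locale isometric_field = M: metric_field g U + N: metric_field h V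
  for g :: "'a::euclidean_space local_metric" and U and h :: "'b::euclidean_space local_metric" and V +
  fixes F :: "'a \<Rightarrow> 'b" and W
  assumes open_W: "open W" and W_sub: "W \<subseteq> U" and F_in: "y \<in> W \<Longrightarrow> F y \<in> V"
    and smooth_F: "smooth_on F W"
    and isom: "y \<in> W \<Longrightarrow> h (F y) (D F y u) (D F y v) = g y u v"
begin

lemma W_U: "y \<in> W \<Longrightarrow> y \<in> U" using W_sub by blast

text \<open>The ambient covariant derivative, along F, of the image of the coordinate-constant field
  v: tangential and normal part together.\<close>

definition "hess y u v = D (\<lambda>z. D F z v) y u + christoffel h (F y) (D F y u) (D F y v)"

text \<open>The tangential part is removed by an explicit formula, justified by
  \<open>hess_tangential\<close>, so that bilinearity is a computation; agreement with
  \<open>second_fundamental_form\<close> is shown once the charts are in place.\<close>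

definition "sff y u v = hess y u v - D F y (christoffel g y u v)"

lemma F_deriv: "y \<in> W \<Longrightarrow> (F has_derivative D F y) (at y)"
  by (rule smooth_on_D_works[OF smooth_F])

lemma DF_deriv: "y \<in> W \<Longrightarrow> ((\<lambda>z. D F z v) has_derivative D (\<lambda>z. D F z v) y) (at y)"
  by (rule smooth_on_D_works[OF smooth_on_D[OF smooth_F]])

lemma linear_DF: "y \<in> W \<Longrightarrow> linear (D F y)"
  by (rule linear_frechet_derivative[OF smooth_on_differentiable[OF smooth_F]])

lemma D2F_sym: "y \<in> W \<Longrightarrow> D (\<lambda>z. D F z v) y u = D (\<lambda>z. D F z u) y v"
  by (rule second_derivative_symmetric[OF open_W _ smooth_F])

lemma hess_sym: "y \<in> W \<Longrightarrow> hess y u v = hess y v u"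
  by (simp add: hess_def D2F_sym[of y v u] N.christoffel_sym[OF F_in, of y "D F y u" "D F y v"])

lemma linear_hess:
  assumes y: "y \<in> W"
  shows "linear (\<lambda>u. hess y u v)"
proof (rule linearI)
  note l = linear_frechet_derivative[OF smooth_on_differentiable[OF smooth_on_D[OF smooth_F] y], of v]
  note N = N.christoffel_simps[OF F_in[OF y]]
  fix u u' :: 'a and c
  show "hess y (u + u') v = hess y u v + hess y u' v"
    unfolding hess_def linear_add[OF linear_DF[OF y]] N(1) linear_add[OF l] by simp
  show "hess y (c *\<^sub>R u) v = c *\<^sub>R hess y u v"
    unfolding hess_def linear_scale[OF linear_DF[OF y]] N(3) linear_scale[OF l]
    by (simp add: scaleR_add_right)
qed

lemma bilinear_sff:
  assumes y: "y \<in> W"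
  shows "bilinear (sff y)"
proof -
  have sym: "sff y u v = sff y v u" for u v
    by (simp add: sff_def hess_sym[OF y, of u v] M.christoffel_sym[OF W_U[OF y], of u v])
  have "linear (\<lambda>u. sff y u v)" for v
  proof (rule linearI)
    note M = M.christoffel_simps[OF W_U[OF y]]
    fix u u' :: 'a and c
    show "sff y (u + u') v = sff y u v + sff y u' v"
      unfolding sff_def linear_add[OF linear_hess[OF y]] M(1) linear_add[OF linear_DF[OF y]] by simp
    show "sff y (c *\<^sub>R u) v = c *\<^sub>R sff y u v"
      unfolding sff_def linear_scale[OF linear_hess[OF y]] M(3) linear_scale[OF linear_DF[OF y]]
      by (simp add: scaleR_diff_right)
  qed
  moreover have "(\<lambda>v. sff y v u) = sff y u" for u by (rule ext) (rule sym)
  ultimately show ?thesis unfolding bilinear_def by metis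
qed

lemma sff_sym: "y \<in> W \<Longrightarrow> sff y u v = sff y v u"
  by (simp add: sff_def hess_sym[of y u v] M.christoffel_sym[OF W_U, of y u v])

lemma hess_compat:
  assumes y: "y \<in> W"
  shows "dmetric g y w u v = h (F y) (hess y w u) (D F y v) + h (F y) (D F y u) (hess y w v)"
proof -
  have "dmetric g y w u v = D (\<lambda>z. h (F z) (D F z u) (D F z v)) y w"
    unfolding dmetric_def
    by (subst frechet_derivative_transform_within_open[OF M.g_diff[OF W_U[OF y]] open_W y isom[symmetric]]) simp_all
  then show ?thesis
    using D_eq[OF N.has_derivative_g_along[OF F_in[OF y] F_deriv[OF y] DF_deriv[OF y] DF_deriv[OF y]], of u v]
    by (simp add: hess_def)
qed

text \<open>By \<open>hess_sym\<close> and \<open>hess_compat\<close>, \<open>hess\<close> satisfies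
  the symmetry and compatibility conditions that characterize the Levi-Civita connection of g, so
  Koszul's formula identifies its tangential part.\<close>

lemma hess_tangential:
  assumes y: "y \<in> W"
  shows "h (F y) (hess y u v) (D F y z) = g y (christoffel g y u v) z"
  using M.koszul[OF W_U[OF y], of u v z] hess_compat[OF y, of u v z] hess_compat[OF y, of v u z]
    hess_compat[OF y, of z u v] hess_sym[OF y, of u v] hess_sym[OF y, of z u] hess_sym[OF y, of z v]
    N.sym_g[OF F_in[OF y], of "D F y u" "hess y v z"] N.sym_g[OF F_in[OF y], of "D F y v" "hess y u z"]
    N.sym_g[OF F_in[OF y], of "D F y u" "hess y z v"]
  by simp

lemma sff_normal: "y \<in> W \<Longrightarrow> h (F y) (sff y u v) (D F y z) = 0"
  by (simp add: sff_def N.g_simps F_in hess_tangential isom)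

lemma h_hess_hess:
  assumes y: "y \<in> W"
  shows "h (F y) (hess y u v) (hess y w z) =
    h (F y) (sff y u v) (sff y w z) + g y (christoffel g y u v) (christoffel g y w z)"
proof -
  have "hess y u v = sff y u v + D F y (christoffel g y u v)" for u v by (simp add: sff_def)
  then show ?thesis
    using sff_normal[OF y] sff_normal[OF y, of w z, unfolded N.sym_g[OF F_in[OF y], of "sff y w z"]]
    by (simp add: N.g_simps F_in y isom)
qed

text \<open>The identity \<open>hess_tangential\<close> is differentiated along u and
  antisymmetrized in u, v. Second covariant derivatives produce the two curvatures; the products of
  first ones reduce by \<open>h_hess_hess\<close> to the terms in \<open>sff\<close>, the tangential
  contributions cancelling.\<close>

lemma gauss:
  assumes y: "y \<in> W"
  shows "g y (curvature g y u v w) z =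
    h (F y) (curvature h (F y) (D F y u) (D F y v) (D F y w)) (D F y z)
    + h (F y) (sff y v w) (sff y u z) - h (F y) (sff y u w) (sff y v z)"
proof -
  note yU = W_U[OF y] and FV = F_in[OF y]
  let ?\<Gamma> = "christoffel h" and ?\<Gamma>' = "christoffel g"
  \<comment> \<open>The ordinary derivative of \<open>hess y v w\<close> in direction u; adding the
    connection term makes it covariant.\<close>
  define dh where "dh u v w = D (\<lambda>y. D (\<lambda>z. D F z w) y v) y u
    + (D (\<lambda>x. ?\<Gamma> x (D F y v) (D F y w)) (F y) (D F y u)
      + ?\<Gamma> (F y) (D (\<lambda>z. D F z v) y u) (D F y w)
      + ?\<Gamma> (F y) (D F y v) (D (\<lambda>z. D F z w) y u))" for u v w
  have hess': "((\<lambda>y. hess y v w) has_derivative (\<lambda>u. dh u v w)) (at y)" for v w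
    unfolding hess_def dh_def
    by (intro has_derivative_add N.has_derivative_christoffel_along FV F_deriv DF_deriv y
        smooth_on_D_works[OF smooth_on_D[OF smooth_on_D[OF smooth_F]] y])
  have eq: "h (F y) (dh u v w + ?\<Gamma> (F y) (D F y u) (hess y v w)) (D F y z)
      + h (F y) (hess y v w) (hess y u z) =
      g y (D (\<lambda>y. ?\<Gamma>' y v w) y u + ?\<Gamma>' y u (?\<Gamma>' y v w)) z + g y (?\<Gamma>' y v w) (?\<Gamma>' y u z)" for u v
  proof -
    note 1 = N.has_derivative_g_along[OF FV F_deriv[OF y] hess' DF_deriv[OF y], of v w z]
    have "((\<lambda>y. g y (?\<Gamma>' y v w) z) has_derivative (\<lambda>u. g y (D (\<lambda>y. ?\<Gamma>' y v w) y u + ?\<Gamma>' y u (?\<Gamma>' y v w)) z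
        + g y (?\<Gamma>' y v w) (0 + ?\<Gamma>' y u z))) (at y)"
      by (intro M.has_derivative_g_along[where F = "\<lambda>y. y"] yU has_derivative_ident has_derivative_const
          D_works M.christoffel_differentiable)
    from has_derivative_transform_within_open[OF this open_W y hess_tangential[symmetric]]
    have "((\<lambda>y. h (F y) (hess y v w) (D F y z)) has_derivative (\<lambda>u. g y (D (\<lambda>y. ?\<Gamma>' y v w) y u + ?\<Gamma>' y u (?\<Gamma>' y v w)) z
        + g y (?\<Gamma>' y v w) (0 + ?\<Gamma>' y u z))) (at y)" by simp
    from fun_cong[OF has_derivative_unique[OF 1 this], of u] show ?thesis
      by (simp add: hess_def)
  qed
  \<comment> \<open>Third derivatives are exchanged in u, v only, so symmetry is applied to the
    first derivative of F along w.\<close>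
  have d3: "D (\<lambda>y. D (\<lambda>z. D F z w) y v) y u = D (\<lambda>y. D (\<lambda>z. D F z w) y u) y v"
    by (rule second_derivative_symmetric[OF open_W y smooth_on_D[OF smooth_F]])
  have R: "(dh u v w + ?\<Gamma> (F y) (D F y u) (hess y v w)) - (dh v u w + ?\<Gamma> (F y) (D F y v) (hess y u w)) =
      curvature h (F y) (D F y u) (D F y v) (D F y w)"
    using D2F_sym[OF y, of u v] d3 unfolding dh_def hess_def curvature_def
    by (simp add: N.christoffel_simps[OF FV] algebra_simps)
  show ?thesis
    using eq[of u v] eq[of v u] arg_cong[OF R, of "\<lambda>t. h (F y) t (D F y z)"]
    unfolding h_hess_hess[OF y] curvature_def[of g]
    by (simp add: N.g_simps[OF FV] M.g_simps[OF yU])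
qed

end

section \<open>Inner products and sectional curvature\<close>

locale pos_form =
  fixes g :: "'a::euclidean_space \<Rightarrow> 'a \<Rightarrow> real"
  assumes bilinear: "bilinear g" and sym: "g u v = g v u" and pos: "u \<noteq> 0 \<Longrightarrow> 0 < g u u"
begin

lemma simps:
  "g (u + u') v = g u v + g u' v" "g u (v + v') = g u v + g u v'"
  "g (u - u') v = g u v - g u' v" "g u (v - v') = g u v - g u v'"
  "g (a *\<^sub>R u) v = a * g u v" "g u (a *\<^sub>R v) = a * g u v"
  "g (- u) v = - g u v" "g u (- v) = - g u v" "g 0 v = 0" "g u 0 = 0"
  using bilinear
  by (simp_all add: bilinear_ladd bilinear_radd bilinear_lsub bilinear_rsub bilinear_lmul bilinear_rmul
      bilinear_lneg bilinear_rneg bilinear_lzero bilinear_rzero)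

lemma sum_left: "g (\<Sum>i\<in>I. f i) v = (\<Sum>i\<in>I. g (f i) v)"
  using bilinear by (simp add: bilinear_def linear_sum[of "\<lambda>u. g u v"])

lemma nonneg: "0 \<le> g u u"
  using pos[of u] by (cases "u = 0") (auto simp: simps)

lemma zero_iff: "g u u = 0 \<longleftrightarrow> u = 0"
  using pos[of u] simps(9)[of u] by (metis less_irrefl)

lemma gram_pos:
  assumes "independent {u, v}" "u \<noteq> v"
  shows "0 < g u u * g v v - (g u v)\<^sup>2"
proof -
  have "v \<noteq> 0" using assms dependent_zero by blast
  then have v: "0 < g v v" by (rule pos)
  \<comment> \<open>\<open>g v v\<close> times the component of u orthogonal to v; its squared
    length is \<open>g v v\<close> times the Gram determinant.\<close>
  let ?w = "g v v *\<^sub>R u - g u v *\<^sub>R v"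
  have "?w \<noteq> 0"
  proof
    assume "?w = 0"
    then have "(1 / g v v) *\<^sub>R (g v v *\<^sub>R u) = (1 / g v v) *\<^sub>R (g u v *\<^sub>R v)" by simp
    then have "u = (g u v / g v v) *\<^sub>R v" using v by simp
    then have "u \<in> span {v}" by (metis span_base span_scale singletonI)
    then show False using assms by (auto simp: independent_insert)
  qed
  then have "0 < g ?w ?w" by (rule pos)
  also have "g ?w ?w = g v v * (g u u * g v v - (g u v)\<^sup>2)"
    by (simp add: simps sym[of v u] algebra_simps power2_eq_square)
  finally show ?thesis using v by (simp add: zero_less_mult_iff)
qed

definition "orthonormal S \<longleftrightarrow> (\<forall>u\<in>S. \<forall>v\<in>S. g u v = (if u = v then 1 else 0))"

lemma orthonormal_subset: "orthonormal S \<Longrightarrow> T \<subseteq> S \<Longrightarrow> orthonormal T"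
  unfolding orthonormal_def by blast

lemma orthonormal_basis_iff: "orthonormal_basis g B \<longleftrightarrow> orthonormal B \<and> span B = UNIV"
  by (auto simp: orthonormal_basis_def orthonormal_def)

lemma orthogonal_span:
  assumes "\<And>e. e \<in> B \<Longrightarrow> g w e = 0" "v \<in> span B"
  shows "g w v = 0"
  using assms(2) by (induction rule: span_induct) (auto simp: simps assms(1) intro!: subspaceI)

lemma orthonormal_independent:
  assumes "orthonormal S"
  shows "independent S"
  unfolding dependent_def
proof
  assume "\<exists>a\<in>S. a \<in> span (S - {a})"
  then obtain a where a: "a \<in> S" "a \<in> span (S - {a})" by blast
  have "g a a = 0"
    by (rule orthogonal_span[OF _ a(2)]) (use assms a(1) in \<open>auto simp: orthonormal_def\<close>)
  then show False using assms a(1) by (auto simp: orthonormal_def)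
qed

lemma orthonormal_finite: "orthonormal S \<Longrightarrow> finite S"
  using orthonormal_independent independent_imp_finite by blast

lemma orthonormal_project:
  assumes B: "orthonormal B" "e \<in> B"
  shows "g (v - (\<Sum>b\<in>B. g v b *\<^sub>R b)) e = 0"
proof -
  have "(\<Sum>b\<in>B. g v b * g b e) = (\<Sum>b\<in>B. if b = e then g v b else 0)"
    using B by (intro sum.cong) (auto simp: orthonormal_def)
  then show ?thesis using B orthonormal_finite[OF B(1)] by (simp add: simps sum_left)
qed

lemma orthonormal_expand:
  assumes B: "orthonormal B" and v: "v \<in> span B"
  shows "v = (\<Sum>b\<in>B. g v b *\<^sub>R b)"
proof -
  let ?w = "v - (\<Sum>b\<in>B. g v b *\<^sub>R b)"
  have "?w \<in> span B" by (intro span_diff v span_sum span_scale span_base)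
  then have "g ?w ?w = 0" using orthogonal_span orthonormal_project[OF B] by blast
  then show ?thesis by (simp add: zero_iff)
qed

text \<open>An orthonormal set between S and T of maximal cardinality spans T, since otherwise a
  Gram-Schmidt step would enlarge it. T will be a plane section or the whole tangent space.\<close>

lemma orthonormal_extend:
  assumes T: "subspace T" and S: "S \<subseteq> T" "orthonormal S"
  obtains B where "S \<subseteq> B" "B \<subseteq> T" "orthonormal B" "span B = T"
proof -
  let ?P = "\<lambda>B. S \<subseteq> B \<and> B \<subseteq> T \<and> orthonormal B"
  have "card B < Suc DIM('a)" if "?P B" for B
    using that orthonormal_independent[of B] independent_bound[of B] by auto
  then obtain B where B: "?P B" and max: "\<And>C. ?P C \<Longrightarrow> card C \<le> card B"
    using ex_has_greatest_nat[of ?P S card "Suc DIM('a)"] S by blast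
  have "t \<in> span B" if t: "t \<in> T" for t
  proof (rule ccontr)
    assume nt: "t \<notin> span B"
    let ?w = "t - (\<Sum>b\<in>B. g t b *\<^sub>R b)"
    have sp: "(\<Sum>b\<in>B. g t b *\<^sub>R b) \<in> span B" by (intro span_sum span_scale span_base)
    then have "?w \<noteq> 0" using nt by auto
    then have w: "0 < g ?w ?w" by (rule pos)
    define n where "n = (1 / sqrt (g ?w ?w)) *\<^sub>R ?w"
    have "span B \<subseteq> T" using B T span_minimal by blast
    then have "n \<in> T" unfolding n_def using sp t by (intro subspace_scale subspace_diff T) auto
    have nn: "g n n = 1"
    proof -
      have "g n n = g ?w ?w / (sqrt (g ?w ?w) * sqrt (g ?w ?w))"
        unfolding n_def simps(5,6) by simp
      then show ?thesis using w by simp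
    qed
    have ne: "g n e = 0" if "e \<in> B" for e
      using orthonormal_project[of B e t] B that by (simp add: n_def simps(5))
    then have en: "g e n = 0" if "e \<in> B" for e
      using that sym[of e n] by simp
    have "orthonormal (insert n B)"
      using B nn ne en unfolding orthonormal_def by auto
    then have "card (insert n B) \<le> card B" using B \<open>n \<in> T\<close> by (intro max) auto
    moreover have "n \<notin> B" using nn ne by auto
    ultimately show False using B orthonormal_finite[of B] by simp
  qed
  then have "span B = T" using B T span_minimal by blast
  then show ?thesis using B that by blast
qed

text \<open>Expanding the vectors of B in C, the coefficients summed over B give
  \<open>g a b\<close> by Parseval. This frees mean curvature and Ricci curvature from the basis
  picked by \<open>SOME\<close>.\<close>

lemma trace_basis_independent:
  fixes \<beta> :: "'a \<Rightarrow> 'a \<Rightarrow> 'c::real_vector"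
  assumes \<beta>: "bilinear \<beta>" and B: "orthonormal_basis g B" and C: "orthonormal_basis g C"
  shows "(\<Sum>e\<in>B. \<beta> e e) = (\<Sum>e\<in>C. \<beta> e e)"
proof -
  have oB: "orthonormal B" "\<And>v. v \<in> span B" and oC: "orthonormal C" "\<And>v. v \<in> span C"
    using B C by (auto simp: orthonormal_basis_iff)
  have ex: "\<beta> e e = (\<Sum>a\<in>C. \<Sum>b\<in>C. (g e a * g e b) *\<^sub>R \<beta> a b)" for e
  proof -
    have "\<beta> e e = \<beta> (\<Sum>a\<in>C. g e a *\<^sub>R a) (\<Sum>b\<in>C. g e b *\<^sub>R b)"
      using orthonormal_expand[OF oC, of e] by simp
    then show ?thesis
      unfolding bilinear_sum[OF \<beta>] sum.cartesian_product
      by (simp add: bilinear_lmul[OF \<beta>] bilinear_rmul[OF \<beta>] case_prod_beta mult.commute)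
  qed
  have gs: "(\<Sum>e\<in>B. g e a * g e b) = g a b" for a b
    using arg_cong[OF orthonormal_expand[OF oB, of a], of "\<lambda>v. g v b"]
    by (simp add: sum_left simps(5) sym[of _ a])
  have "(\<Sum>e\<in>B. \<beta> e e) = (\<Sum>a\<in>C. \<Sum>e\<in>B. \<Sum>b\<in>C. (g e a * g e b) *\<^sub>R \<beta> a b)"
    unfolding ex by (rule sum.swap)
  also have "\<dots> = (\<Sum>a\<in>C. \<Sum>b\<in>C. \<Sum>e\<in>B. (g e a * g e b) *\<^sub>R \<beta> a b)"
    by (intro sum.cong refl sum.swap)
  also have "\<dots> = (\<Sum>a\<in>C. \<Sum>b\<in>C. g a b *\<^sub>R \<beta> a b)"
    by (simp add: gs flip: scaleR_sum_left)
  also have "\<dots> = (\<Sum>a\<in>C. \<Sum>b\<in>C. if a = b then \<beta> a b else 0)"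
    using oC by (intro sum.cong) (auto simp: orthonormal_def)
  also have "\<dots> = (\<Sum>a\<in>C. \<beta> a a)"
    using orthonormal_finite[OF oC(1)] by simp
  finally show ?thesis .
qed

end

section \<open>Independence of sectional curvature from the basis of the plane\<close>

lemma sectional_curvature_span:
  fixes M :: "('p, 'a::euclidean_space) riem_space" and p :: 'p
  defines "g \<equiv> metric_at M p"
  defines "K \<equiv> \<lambda>u v. g (curvature (metric_near M p) (coords_at M p) u v v) u"
  assumes "pos_form g"
    and scale: "\<And>a b c d u v. K (a *\<^sub>R u + b *\<^sub>R v) (c *\<^sub>R u + d *\<^sub>R v) = (a * d - b * c)\<^sup>2 * K u v"
    and uv: "independent {u, v}" "u \<noteq> v"
  shows "sectional_curvature M p (span {u, v}) = K u v / (g u u * g v v - (g u v)\<^sup>2)"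
proof -
  interpret pos_form g by fact
  let ?P = "\<lambda>(x, y). x \<noteq> y \<and> independent {x, y} \<and> span {x, y} = span {u, v}"
  let ?G = "\<lambda>u v. g u u * g v v - (g u v)\<^sup>2"
  obtain x y where xy: "Eps ?P = (x, y)" by fastforce
  have "?P (Eps ?P)" by (rule someI[of ?P "(u, v)"]) (use uv in simp)
  then have P: "x \<noteq> y" "independent {x, y}" "span {x, y} = span {u, v}" by (auto simp: xy)
  have ex: "\<exists>a b. z = a *\<^sub>R u + b *\<^sub>R v" if "z \<in> span {u, v}" for z
    using that by (auto simp: span_insert span_singleton) (metis add.commute diff_add_cancel)
  have "x \<in> span {u, v}" "y \<in> span {u, v}" using P(3) span_base[of _ "{x, y}"] by auto
  then obtain a b c d where x: "x = a *\<^sub>R u + b *\<^sub>R v" and y: "y = c *\<^sub>R u + d *\<^sub>R v"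
    using ex by metis
  \<comment> \<open>Numerator and Gram determinant both acquire the squared determinant of the
    change of basis, which is nonzero because the Gram determinant of x, y is positive.\<close>
  have G: "?G x y = (a * d - b * c)\<^sup>2 * ?G u v"
    unfolding x y by (simp add: simps sym[of v u] power2_eq_square algebra_simps)
  have "0 < ?G x y" by (rule gram_pos[OF P(2,1)])
  then have ne: "(a * d - b * c)\<^sup>2 \<noteq> 0" unfolding G by auto
  have "sectional_curvature M p (span {u, v}) = K x y / ?G x y"
    unfolding sectional_curvature_def xy by (simp add: K_def g_def Let_def)
  also have "\<dots> = ((a * d - b * c)\<^sup>2 * K u v) / ((a * d - b * c)\<^sup>2 * ?G u v)"
    unfolding G unfolding x y scale ..
  finally show ?thesis using ne by simp
qed

context metric_field
begin

lemma pos_form: "x \<in> V \<Longrightarrow> pos_form (g x)"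
  by unfold_locales (auto intro: bilinear_g sym_g pos_g)

text \<open>The curvature form is alternating in its first pair and, by pair symmetry, in its last;
  on a plane each pair contributes the determinant a d - b c, up to opposite signs that
  cancel.\<close>

lemma curvature_scale:
  assumes x: "x \<in> V"
  shows "g x (R x (a *\<^sub>R u + b *\<^sub>R v) (c *\<^sub>R u + d *\<^sub>R v) (c *\<^sub>R u + d *\<^sub>R v)) (a *\<^sub>R u + b *\<^sub>R v) =
    (a * d - b * c)\<^sup>2 * g x (R x u v v) u"
proof -
  define T where "T u v w z = g x (R x u v w) z" for u v w z
  have a12: "T u v w z = - T v u w z" for u v w z
    unfolding T_def by (subst curvature_anti12) (simp add: g_simps[OF x])
  have a34: "T u v w z = - T u v z w" for u v w z
    unfolding T_def by (rule curvature_anti34[OF x])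
  have b: "T u v w z + T v w u z + T w u v z = 0" for u v w z
    using arg_cong[OF bianchi[OF x, of u v w], of "\<lambda>t. g x t z"] by (simp add: T_def g_simps[OF x])
  note p = curvature_pair_symmetry[of T, OF a12 a34 b]
  have l1: "T (a *\<^sub>R u + b *\<^sub>R v) w z t = a * T u w z t + b * T v w z t" for a b u v w z t
    unfolding T_def linear_add[OF linear_curvature1[OF x]] linear_scale[OF linear_curvature1[OF x]]
    by (simp add: g_simps[OF x])
  have l2: "T w (a *\<^sub>R u + b *\<^sub>R v) z t = a * T w u z t + b * T w v z t" for a b u v w z t
    using a12[of w "a *\<^sub>R u + b *\<^sub>R v" z t] a12[of w u z t] a12[of w v z t] l1[of a u b v w z t] by simp
  have T0: "T u u w z = 0" for u w z using a12[of u u w z] by simp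
  have T12: "T (a *\<^sub>R u + b *\<^sub>R v) (c *\<^sub>R u + d *\<^sub>R v) w z = (a * d - b * c) * T u v w z" for a b c d w z
    using a12[of v u w z] by (simp add: l1 l2 T0 algebra_simps)
  let ?X = "a *\<^sub>R u + b *\<^sub>R v" and ?Y = "c *\<^sub>R u + d *\<^sub>R v"
  have "T ?X ?Y ?Y ?X = (a * d - b * c) * T u v ?Y ?X" by (rule T12)
  also have "T u v ?Y ?X = T ?Y ?X u v" by (rule p)
  also have "T ?Y ?X u v = (c * b - d * a) * T u v u v" by (rule T12)
  also have "T u v u v = - T u v v u" by (rule a34)
  also have "(a * d - b * c) * ((c * b - d * a) * - T u v v u) = (a * d - b * c)\<^sup>2 * T u v v u"
    by (simp add: power2_eq_square algebra_simps)
  finally show ?thesis by (simp add: T_def)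
qed

end

section \<open>The pointwise inequality\<close>

context pos_form
begin

lemma orthonormal_basis_card: "orthonormal_basis g C \<Longrightarrow> card C = DIM('a)"
  using orthonormal_independent[of C] dim_eq_card_independent[of C] dim_span[of C]
  by (simp add: orthonormal_basis_iff)

lemma orthonormal_basis_extend:
  assumes "orthonormal S"
  obtains C where "S \<subseteq> C" "orthonormal_basis g C"
  using orthonormal_extend[OF subspace_UNIV subset_UNIV assms] orthonormal_basis_iff by metis

lemma plane_orthonormal:
  assumes "plane_section \<pi>"
  obtains a b where "a \<noteq> b" "orthonormal {a, b}" "\<pi> = span {a, b}"
proof -
  obtain S where S: "S \<subseteq> \<pi>" "orthonormal S" "span S = \<pi>"
    using orthonormal_extend[of \<pi> "{}"] assms by (auto simp: plane_section_def orthonormal_def)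
  then have "card S = 2"
    using assms orthonormal_independent[of S] dim_span_eq_card_independent by (metis plane_section_def)
  then show ?thesis using S that by (metis card_2_iff)
qed

lemma plane_section_span: "a \<noteq> b \<Longrightarrow> orthonormal {a, b} \<Longrightarrow> plane_section (span {a, b})"
  using orthonormal_independent[of "{a, b}"] by (simp add: plane_section_def dim_eq_card_independent)

text \<open>Consecutive pairs from an orthonormal basis span such planes. It ensures that the
  infimum in \<open>K_inf\<close> is not over the empty set.\<close>

lemma exists_orthogonal_planes:
  assumes "2 * q \<le> DIM('a)"
  shows "\<exists>\<pi>. (\<forall>i<q. plane_section (\<pi> i)) \<and> (\<forall>i<q. \<forall>j<q. i \<noteq> j \<longrightarrow> (\<forall>u\<in>\<pi> i. \<forall>v\<in>\<pi> j. g u v = 0))"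
proof -
  obtain C where C: "orthonormal_basis g C"
    using orthonormal_basis_extend[of "{}"] by (auto simp: orthonormal_def)
  then have oC: "orthonormal C" by (simp add: orthonormal_basis_iff)
  obtain e where "bij_betw e {0..<DIM('a)} C"
    using ex_bij_betw_nat_finite[OF orthonormal_finite[OF oC]] orthonormal_basis_card[OF C] by metis
  then have inj: "inj_on e {0..<DIM('a)}" and ran: "\<And>k. k < DIM('a) \<Longrightarrow> e k \<in> C"
    by (auto simp: bij_betw_def)
  have g: "g (e k) (e l) = (if k = l then 1 else 0)" if "k < DIM('a)" "l < DIM('a)" for k l
    using oC ran[OF that(1)] ran[OF that(2)] inj_onD[OF inj, of k l] that by (auto simp: orthonormal_def)
  let ?\<pi> = "\<lambda>i. span {e (2 * i), e (Suc (2 * i))}"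
  have "plane_section (?\<pi> i)" if "i < q" for i
    using that assms inj_onD[OF inj, of "2 * i" "Suc (2 * i)"]
    by (intro plane_section_span) (auto simp: orthonormal_def g)
  moreover have "g u v = 0" if ij: "i < q" "j < q" "i \<noteq> j" and u: "u \<in> ?\<pi> i" and v: "v \<in> ?\<pi> j" for i j u v
  proof (rule orthogonal_span[OF _ v])
    fix x assume "x \<in> {e (2 * j), e (Suc (2 * j))}"
    then have "g x y = 0" if "y \<in> {e (2 * i), e (Suc (2 * i))}" for y
      using that ij assms by (auto simp: g)
    from orthogonal_span[OF this u] show "g u x = 0" using sym[of u x] by simp
  qed
  ultimately show ?thesis by (intro exI[of _ ?\<pi>]) blast
qed

end

text \<open>\<open>K\<close> is the sectional curvature given by the Gauss equation of a minimal
  totally real immersion with second fundamental form \<open>\<sigma>\<close>.\<close>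

locale minimal_gauss = pos_form g + h: pos_form h
  for g :: "'a::euclidean_space \<Rightarrow> 'a \<Rightarrow> real" and h :: "'b::euclidean_space \<Rightarrow> 'b \<Rightarrow> real" +
  fixes \<sigma> :: "'a \<Rightarrow> 'a \<Rightarrow> 'b" and K :: "'a set \<Rightarrow> real" and c :: real
  assumes bil_\<sigma>: "bilinear \<sigma>"
    and sym_\<sigma>: "\<sigma> u v = \<sigma> v u"
    and trace_\<sigma>: "orthonormal_basis g C \<Longrightarrow> (\<Sum>e\<in>C. \<sigma> e e) = 0"
    and K: "\<lbrakk>u \<noteq> v; orthonormal {u, v}\<rbrakk> \<Longrightarrow>
      K (span {u, v}) = c + h (\<sigma> u u) (\<sigma> v v) - h (\<sigma> u v) (\<sigma> u v)"
begin

lemma ricci_sum: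
  assumes C: "orthonormal_basis g C" and u: "u \<in> C"
  shows "(\<Sum>e\<in>C - {u}. K (span {u, e})) = (real DIM('a) - 1) * c - (\<Sum>e\<in>C. h (\<sigma> u e) (\<sigma> u e))"
proof -
  have oC: "orthonormal C" using C by (simp add: orthonormal_basis_iff)
  have fin: "finite C" by (rule orthonormal_finite[OF oC])
  have "(\<Sum>e\<in>C - {u}. K (span {u, e})) = (\<Sum>e\<in>C - {u}. c + (h (\<sigma> e e) (\<sigma> u u) - h (\<sigma> u e) (\<sigma> u e)))"
  proof (rule sum.cong[OF refl])
    fix e assume "e \<in> C - {u}"
    then have "u \<noteq> e" "orthonormal {u, e}" using u by (auto intro: orthonormal_subset[OF oC])
    from K[OF this] show "K (span {u, e}) = c + (h (\<sigma> e e) (\<sigma> u u) - h (\<sigma> u e) (\<sigma> u e))"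
      using h.sym[of "\<sigma> u u" "\<sigma> e e"] by simp
  qed
  also have "\<dots> = real (card (C - {u})) * c + (\<Sum>e\<in>C - {u}. h (\<sigma> e e) (\<sigma> u u) - h (\<sigma> u e) (\<sigma> u e))"
    by (simp add: sum.distrib)
  \<comment> \<open>The summand vanishes at e = u, so the sum may run over all of C, where the trace
    of \<sigma> appears.\<close>
  also have "(\<Sum>e\<in>C - {u}. h (\<sigma> e e) (\<sigma> u u) - h (\<sigma> u e) (\<sigma> u e))
      = (\<Sum>e\<in>C. h (\<sigma> e e) (\<sigma> u u) - h (\<sigma> u e) (\<sigma> u e))"
    using sum.remove[OF fin u, of "\<lambda>e. h (\<sigma> e e) (\<sigma> u u) - h (\<sigma> u e) (\<sigma> u e)"] by simp
  also have "\<dots> = h (\<Sum>e\<in>C. \<sigma> e e) (\<sigma> u u) - (\<Sum>e\<in>C. h (\<sigma> u e) (\<sigma> u e))"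
    by (simp add: sum_subtractf h.sum_left)
  also have "real (card (C - {u})) = real DIM('a) - 1"
    using fin u orthonormal_basis_card[OF C] by (simp add: of_nat_diff Suc_leI)
  finally show ?thesis by (simp add: trace_\<sigma>[OF C] h.simps)
qed

text \<open>C remains an argument so that a basis adapted to given planes can be used;
  \<open>ricci_constant\<close> holds for every C.\<close>

definition "sqnorm C = (\<Sum>u\<in>C. \<Sum>e\<in>C. h (\<sigma> u e) (\<sigma> u e))"

text \<open>Each u comes with its own basis B, as \<open>ricci\<close> picks one by
  \<open>SOME\<close>. The sum of |\<sigma>(u, e)|^2 over e is a trace, so it can be moved from B to
  C before summing over the n vectors u of C.\<close>

lemma ricci_constant:
  assumes C: "orthonormal_basis g C"
    and ric: "\<And>u. g u u = 1 \<Longrightarrow> \<exists>B. orthonormal_basis g B \<and> u \<in> B \<and> \<rho> = (\<Sum>e\<in>B - {u}. K (span {u, e}))"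
  shows "real DIM('a) * \<rho> = real DIM('a) * (real DIM('a) - 1) * c - sqnorm C"
proof -
  have "\<rho> = (real DIM('a) - 1) * c - (\<Sum>e\<in>C. h (\<sigma> u e) (\<sigma> u e))" if u: "u \<in> C" for u
  proof -
    have "g u u = 1" using C u by (auto simp: orthonormal_basis_iff orthonormal_def)
    from ric[OF this] obtain B where B: "orthonormal_basis g B" "u \<in> B"
      and "\<rho> = (\<Sum>e\<in>B - {u}. K (span {u, e}))" by blast
    moreover have "bilinear (\<lambda>x y. h (\<sigma> u x) (\<sigma> u y))"
      using bil_\<sigma> by (auto simp: bilinear_def linear_iff h.simps)
    ultimately show ?thesis
      using ricci_sum[OF B] trace_basis_independent[OF _ B(1) C, of "\<lambda>x y. h (\<sigma> u x) (\<sigma> u y)"] by simp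
  qed
  then have "(\<Sum>u\<in>C. \<rho>) = (\<Sum>u\<in>C. (real DIM('a) - 1) * c - (\<Sum>e\<in>C. h (\<sigma> u e) (\<sigma> u e)))"
    by (intro sum.cong refl)
  then show ?thesis
    unfolding sum_subtractf sqnorm_def[symmetric] using orthonormal_basis_card[OF C] by simp
qed

text \<open>Orthonormal bases of the planes are completed to C and only the diagonal blocks of
  \<sigma> are kept. Adding 2 (K - c) to a block cancels its two copies of |\<sigma>(a, b)|^2 and
  completes the square |\<sigma>(a, a) + \<sigma>(b, b)|^2.\<close>

lemma planes_bound:
  assumes pl: "\<forall>i<q. plane_section (\<pi> i)"
    and orth: "\<forall>i<q. \<forall>j<q. i \<noteq> j \<longrightarrow> (\<forall>u\<in>\<pi> i. \<forall>v\<in>\<pi> j. g u v = 0)"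
  shows "\<exists>C. orthonormal_basis g C \<and> 2 * real q * c \<le> 2 * (\<Sum>i<q. K (\<pi> i)) + sqnorm C"
proof -
  have "\<forall>i\<in>{..<q}. \<exists>a b. a \<noteq> b \<and> orthonormal {a, b} \<and> \<pi> i = span {a, b}"
    using plane_orthonormal pl by (metis lessThan_iff)
  then obtain a b where ab: "\<And>i. i < q \<Longrightarrow> a i \<noteq> b i \<and> orthonormal {a i, b i} \<and> \<pi> i = span {a i, b i}"
    unfolding bchoice_iff by auto
  let ?E = "\<lambda>i. {a i, b i}"
  have E\<pi>: "?E i \<subseteq> \<pi> i" if "i < q" for i using ab[OF that] span_superset[of "?E i"] by simp
  have ne: "u \<noteq> v \<and> g u v = 0" if "i < q" "j < q" "i \<noteq> j" "u \<in> ?E i" "v \<in> ?E j" for i j u v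
  proof -
    have "u \<in> \<pi> i" "v \<in> \<pi> j" using that E\<pi> by blast+
    then have "g u v = 0" using orth that by blast
    moreover have "g u u = 1" using ab[OF that(1)] that(4) by (auto simp: orthonormal_def)
    ultimately show ?thesis by auto
  qed
  have "orthonormal (\<Union>i<q. ?E i)"
    unfolding orthonormal_def
  proof (intro ballI)
    fix u v assume "u \<in> (\<Union>i<q. ?E i)" "v \<in> (\<Union>i<q. ?E i)"
    then obtain i j where ij: "i < q" "u \<in> ?E i" "j < q" "v \<in> ?E j" by blast
    show "g u v = (if u = v then 1 else 0)"
    proof (cases "i = j")
      case True
      then show ?thesis using ab[OF ij(1)] ij(2,4) unfolding orthonormal_def by blast
    next
      case False
      then show ?thesis using ne[OF ij(1,3) False ij(2,4)] by simp
    qed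
  qed
  then obtain C where C: "(\<Union>i<q. ?E i) \<subseteq> C" "orthonormal_basis g C" by (rule orthonormal_basis_extend)
  have fin: "finite C" using C(2) orthonormal_finite by (simp add: orthonormal_basis_iff)
  let ?n = "\<lambda>(u, e). h (\<sigma> u e) (\<sigma> u e)"
  have "2 * real q * c = (\<Sum>i<q. 2 * c)" by simp
  also have "\<dots> \<le> (\<Sum>i<q. 2 * K (\<pi> i) + sum ?n (?E i \<times> ?E i))"
  proof (rule sum_mono)
    fix i assume "i \<in> {..<q}"
    then have i: "a i \<noteq> b i" "orthonormal {a i, b i}" "\<pi> i = span {a i, b i}" using ab by auto
    have "sum ?n (?E i \<times> ?E i) = h (\<sigma> (a i) (a i)) (\<sigma> (a i) (a i)) + 2 * h (\<sigma> (a i) (b i)) (\<sigma> (a i) (b i))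
        + h (\<sigma> (b i) (b i)) (\<sigma> (b i) (b i))"
      using i(1) sym_\<sigma>[of "b i" "a i"] by (simp add: sum.cartesian_product[symmetric])
    moreover have "0 \<le> h (\<sigma> (a i) (a i) + \<sigma> (b i) (b i)) (\<sigma> (a i) (a i) + \<sigma> (b i) (b i))"
      by (rule h.nonneg)
    ultimately show "2 * c \<le> 2 * K (\<pi> i) + sum ?n (?E i \<times> ?E i)"
      using K[OF i(1,2)] h.sym[of "\<sigma> (a i) (a i)" "\<sigma> (b i) (b i)"] by (simp add: i(3) h.simps)
  qed
  also have "\<dots> = 2 * (\<Sum>i<q. K (\<pi> i)) + sum ?n (\<Union>i<q. ?E i \<times> ?E i)"
  proof -
    \<comment> \<open>Vectors from different planes are orthogonal unit vectors, hence distinct, so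
      the blocks do not overlap.\<close>
    have "?E i \<times> ?E i \<inter> ?E j \<times> ?E j = {}" if "i < q" "j < q" "i \<noteq> j" for i j
      using ne[OF that] by blast
    then have "sum ?n (\<Union>i<q. ?E i \<times> ?E i) = (\<Sum>i<q. sum ?n (?E i \<times> ?E i))"
      by (intro sum.UNION_disjoint) auto
    then show ?thesis by (simp add: sum.distrib sum_distrib_left)
  qed
  also have "sum ?n (\<Union>i<q. ?E i \<times> ?E i) \<le> sum ?n (C \<times> C)"
    using C(1) fin h.nonneg by (intro sum_mono2) auto
  also have "sum ?n (C \<times> C) = sqnorm C"
    by (simp add: sqnorm_def sum.cartesian_product)
  finally show ?thesis using C(2) by auto
qed

lemma ricci_planes_bound:
  assumes ric: "\<And>u. g u u = 1 \<Longrightarrow> \<exists>B. orthonormal_basis g B \<and> u \<in> B \<and> \<rho> = (\<Sum>e\<in>B - {u}. K (span {u, e}))"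
    and pl: "\<forall>i<q. plane_section (\<pi> i)"
    and orth: "\<forall>i<q. \<forall>j<q. i \<noteq> j \<longrightarrow> (\<forall>u\<in>\<pi> i. \<forall>v\<in>\<pi> j. g u v = 0)"
  shows "\<rho> - 2 / real DIM('a) * (\<Sum>i<q. K (\<pi> i)) \<le> (real DIM('a) - 1 - 2 * real q / real DIM('a)) * c"
proof -
  obtain C where C: "orthonormal_basis g C" "2 * real q * c \<le> 2 * (\<Sum>i<q. K (\<pi> i)) + sqnorm C"
    using planes_bound[OF pl orth] by blast
  have n: "real DIM('a) > 0" by simp
  have "real DIM('a) * \<rho> - 2 * (\<Sum>i<q. K (\<pi> i)) \<le> real DIM('a) * (real DIM('a) - 1) * c - 2 * real q * c"
    using ricci_constant[OF C(1) ric] C(2) by simp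
  then have "(real DIM('a) * \<rho> - 2 * (\<Sum>i<q. K (\<pi> i))) / real DIM('a) \<le>
      (real DIM('a) * (real DIM('a) - 1) * c - 2 * real q * c) / real DIM('a)"
    by (intro divide_right_mono) auto
  then show ?thesis using n by (simp add: diff_divide_distrib add_divide_distrib algebra_simps)
qed

end

section \<open>Passage to charts\<close>

lemma chart_inv_coord:
  assumes "is_chart X \<phi>" "q \<in> fst \<phi>"
  shows "chart_inv \<phi> (snd \<phi> q) = q"
proof -
  have "topspace (subtopology X (fst \<phi>)) = fst \<phi>"
    using assms(1) openin_subset by (auto simp: is_chart_def)
  then have "inj_on (snd \<phi>) (fst \<phi>)"
    using assms(1) homeomorphic_imp_injective_map by (metis is_chart_def)
  then show ?thesis unfolding chart_inv_def using assms(2) by (rule inv_into_f_f)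
qed

lemma chart_open_image:
  assumes \<phi>: "is_chart X \<phi>" and A: "openin X A" "A \<subseteq> fst \<phi>"
  shows "open (snd \<phi> ` A)"
proof -
  have "openin (subtopology X (fst \<phi>)) A"
    using A by (metis inf.absorb1 openin_subtopology_Int)
  then have "openin (top_of_set (snd \<phi> ` fst \<phi>)) (snd \<phi> ` A)"
    using \<phi> homeomorphic_imp_open_map unfolding is_chart_def open_map_def by blast
  then show ?thesis using \<phi> openin_open_eq unfolding is_chart_def by blast
qed

lemma transition_coord: "is_chart X \<phi> \<Longrightarrow> q \<in> fst \<phi> \<Longrightarrow> transition \<phi> \<psi> (snd \<phi> q) = snd \<psi> q"
  by (simp add: transition_def chart_inv_coord)

lemma local_rep_coord: "is_chart X \<phi> \<Longrightarrow> q \<in> fst \<phi> \<Longrightarrow> local_rep \<phi> \<psi> f (snd \<phi> q) = snd \<psi> (f q)"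
  by (simp add: local_rep_def chart_inv_coord)

lemma riemannian_is_chart: "riemannian_manifold M \<Longrightarrow> \<phi> \<in> atlas M \<Longrightarrow> is_chart (top_sp M) \<phi>"
  unfolding riemannian_manifold_def smooth_manifold_def by blast

lemma chart_at_mem:
  assumes "riemannian_manifold M" "p \<in> topspace (top_sp M)"
  shows "chart_at M p \<in> atlas M" "p \<in> fst (chart_at M p)"
proof -
  have "\<exists>\<phi>. \<phi> \<in> atlas M \<and> p \<in> fst \<phi>"
    using assms unfolding riemannian_manifold_def smooth_manifold_def by blast
  from someI_ex[OF this] show "chart_at M p \<in> atlas M" "p \<in> fst (chart_at M p)"
    by (auto simp: chart_at_def)
qed

lemma metric_field_chart:
  assumes M: "riemannian_manifold M" and \<phi>: "\<phi> \<in> atlas M"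
  shows "metric_field (metric M \<phi>) (snd \<phi> ` fst \<phi>)"
proof
  show "open (snd \<phi> ` fst \<phi>)" using riemannian_is_chart[OF assms] by (simp add: is_chart_def)
qed (use M[unfolded riemannian_manifold_def] \<phi> in blast)+

lemma metric_transition:
  assumes M: "riemannian_manifold M" and "\<phi> \<in> atlas M" "\<psi> \<in> atlas M" "p \<in> fst \<phi>" "p \<in> fst \<psi>"
  shows "metric M \<phi> (snd \<phi> p) u v =
    metric M \<psi> (snd \<psi> p) (D (transition \<phi> \<psi>) (snd \<phi> p) u) (D (transition \<phi> \<psi>) (snd \<phi> p) v)"
proof -
  have "snd \<phi> p \<in> overlap \<phi> \<psi>" using assms by (auto simp: overlap_def)
  then have "metric M \<phi> (snd \<phi> p) u v = metric M \<psi> (transition \<phi> \<psi> (snd \<phi> p))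
      (D (transition \<phi> \<psi>) (snd \<phi> p) u) (D (transition \<phi> \<psi>) (snd \<phi> p) v)"
    using M assms(2,3) unfolding riemannian_manifold_def by blast
  then show ?thesis
    unfolding transition_coord[OF riemannian_is_chart[OF M assms(2)] assms(4)] .
qed

lemma transition_differentiable:
  assumes M: "riemannian_manifold M" and "\<phi> \<in> atlas M" "\<psi> \<in> atlas M" "p \<in> fst \<phi>" "p \<in> fst \<psi>"
  shows "transition \<phi> \<psi> differentiable (at (snd \<phi> p))"
proof (rule smooth_on_differentiable)
  show "smooth_on (transition \<phi> \<psi>) (overlap \<phi> \<psi>)"
    using assms unfolding riemannian_manifold_def smooth_manifold_def by blast
  show "snd \<phi> p \<in> overlap \<phi> \<psi>" using assms by (auto simp: overlap_def)
qed

text \<open>The hypothesis gives the isometry identity at p only in the charts that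
  \<open>chart_at\<close> picks for p and f p, which vary with the point. Transition maps carry it,
  point by point, to the fixed pair \<phi>, \<psi>.\<close>

lemma isometric_immersion_chart:
  assumes M: "riemannian_manifold M" and N: "riemannian_manifold N"
    and f: "isometric_immersion M N f" and \<phi>: "\<phi> \<in> atlas M" and \<psi>: "\<psi> \<in> atlas N"
  shows "isometric_field (metric M \<phi>) (snd \<phi> ` fst \<phi>) (metric N \<psi>) (snd \<psi> ` fst \<psi>)
    (local_rep \<phi> \<psi> f) (snd \<phi> ` (fst \<phi> \<inter> f -` fst \<psi>))"
proof -
  note cM = riemannian_is_chart[OF M] and cN = riemannian_is_chart[OF N]
  have cont: "continuous_map (top_sp M) (top_sp N) f"
    and smooth: "\<And>\<phi> \<psi>. \<phi> \<in> atlas M \<Longrightarrow> \<psi> \<in> atlas N \<Longrightarrow>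
      smooth_on (local_rep \<phi> \<psi> f) (snd \<phi> ` (fst \<phi> \<inter> f -` fst \<psi>))"
    using f by (auto simp: isometric_immersion_def smooth_map_def)
  have opA: "openin (top_sp M) (A \<inter> f -` B)" if "openin (top_sp M) A" "openin (top_sp N) B" for A B
  proof -
    have "A \<inter> f -` B = A \<inter> {x \<in> topspace (top_sp M). f x \<in> B}"
      using openin_subset[OF that(1)] by auto
    then show ?thesis using that openin_continuous_map_preimage[OF cont] by auto
  qed
  have opM: "openin (top_sp M) (fst \<phi>)" if "\<phi> \<in> atlas M" for \<phi> using cM[OF that] by (simp add: is_chart_def)
  have opN: "openin (top_sp N) (fst \<psi>)" if "\<psi> \<in> atlas N" for \<psi> using cN[OF that] by (simp add: is_chart_def)
  let ?F = "local_rep \<phi> \<psi> f"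
  have iso: "metric N \<psi> (?F y) (D ?F y u) (D ?F y v) = metric M \<phi> y u v"
    if y: "y \<in> snd \<phi> ` (fst \<phi> \<inter> f -` fst \<psi>)" for y u v
  proof -
    obtain p where p: "p \<in> fst \<phi>" "f p \<in> fst \<psi>" "y = snd \<phi> p" using y by auto
    have pM: "p \<in> topspace (top_sp M)" using openin_subset[OF opM[OF \<phi>]] p by blast
    have fpN: "f p \<in> topspace (top_sp N)" using openin_subset[OF opN[OF \<psi>]] p by blast
    define \<phi>' where "\<phi>' = chart_at M p"
    define \<psi>' where "\<psi>' = chart_at N (f p)"
    have \<phi>': "\<phi>' \<in> atlas M" "p \<in> fst \<phi>'" using chart_at_mem[OF M pM] by (auto simp: \<phi>'_def)
    have \<psi>': "\<psi>' \<in> atlas N" "f p \<in> fst \<psi>'" using chart_at_mem[OF N fpN] by (auto simp: \<psi>'_def)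
    let ?F' = "local_rep \<phi>' \<psi>' f" and ?S = "transition \<phi> \<phi>'" and ?T = "transition \<psi>' \<psi>"
    \<comment> \<open>Where both charts of M and, after f, both charts of N are defined. On its open
      image the representation of f in the fixed charts is the one in the chosen charts composed
      with two transitions, so the chain rule applies.\<close>
    let ?A = "(fst \<phi> \<inter> fst \<phi>') \<inter> f -` (fst \<psi> \<inter> fst \<psi>')"
    have "openin (top_sp M) ?A" by (intro opA openin_Int opM opN \<phi> \<phi>' \<psi> \<psi>')
    then have op: "open (snd \<phi> ` ?A)" by (intro chart_open_image[OF cM[OF \<phi>]]) auto
    have yA: "y \<in> snd \<phi> ` ?A" using p \<phi>' \<psi>' by auto
    have S: "?S y = snd \<phi>' p" using transition_coord[OF cM[OF \<phi>] p(1)] p(3) by simp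
    have F': "?F' (snd \<phi>' p) = snd \<psi>' (f p)" by (rule local_rep_coord[OF cM[OF \<phi>'(1)] \<phi>'(2)])
    have d1: "(?S has_derivative D ?S y) (at y)"
      unfolding p(3) by (rule D_works[OF transition_differentiable[OF M \<phi> \<phi>'(1) p(1) \<phi>'(2)]])
    have d2: "(?F' has_derivative D ?F' (snd \<phi>' p)) (at (?S y))"
      unfolding S by (rule smooth_on_D_works[OF smooth[OF \<phi>'(1) \<psi>'(1)]]) (use \<phi>' \<psi>' in auto)
    have d3: "(?T has_derivative D ?T (snd \<psi>' (f p))) (at (?F' (?S y)))"
      unfolding S F' by (rule D_works[OF transition_differentiable[OF N \<psi>'(1) \<psi> \<psi>'(2) p(2)]])
    have "((\<lambda>z. ?T (?F' (?S z))) has_derivative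
        (\<lambda>u. D ?T (snd \<psi>' (f p)) (D ?F' (snd \<phi>' p) (D ?S y u)))) (at y)"
      by (rule has_derivative_compose[OF has_derivative_compose[OF d1 d2] d3])
    moreover have "?T (?F' (?S z)) = ?F z" if "z \<in> snd \<phi> ` ?A" for z
    proof -
      from that obtain q where q: "q \<in> ?A" "z = snd \<phi> q" by blast
      then have "?S z = snd \<phi>' q" "?F' (snd \<phi>' q) = snd \<psi>' (f q)" "?T (snd \<psi>' (f q)) = snd \<psi> (f q)"
          "?F z = snd \<psi> (f q)"
        by (simp_all add: transition_coord[OF cM[OF \<phi>]] transition_coord[OF cN[OF \<psi>'(1)]]
            local_rep_coord[OF cM[OF \<phi>]] local_rep_coord[OF cM[OF \<phi>'(1)]])
      then show ?thesis by simp
    qed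
    ultimately have "(?F has_derivative
        (\<lambda>u. D ?T (snd \<psi>' (f p)) (D ?F' (snd \<phi>' p) (D ?S y u)))) (at y)"
      by (rule has_derivative_transform_within_open[OF _ op yA])
    from fun_cong[OF D_eq[OF this]]
    have DF: "D ?F y u = D ?T (snd \<psi>' (f p)) (D ?F' (snd \<phi>' p) (D ?S y u))" for u .
    have Fy: "?F y = snd \<psi> (f p)" using local_rep_coord[OF cM[OF \<phi>] p(1)] p(3) by simp
    have "metric N \<psi> (?F y) (D ?F y u) (D ?F y v) =
        metric N \<psi>' (snd \<psi>' (f p)) (D ?F' (snd \<phi>' p) (D ?S y u)) (D ?F' (snd \<phi>' p) (D ?S y v))"
      unfolding DF Fy by (rule metric_transition[OF N \<psi>'(1) \<psi> \<psi>'(2) p(2), symmetric])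
    also have "\<dots> = metric M \<phi>' (snd \<phi>' p) (D ?S y u) (D ?S y v)"
    proof -
      have "metric_at N (f p) (tangent_map M N f p a) (tangent_map M N f p b) = metric_at M p a b" for a b
        using f pM by (simp add: isometric_immersion_def)
      then show ?thesis
        unfolding metric_at_def metric_near_def tangent_map_def rep_at_def coords_at_def \<phi>'_def \<psi>'_def .
    qed
    also have "\<dots> = metric M \<phi> y u v"
      unfolding p(3) by (rule metric_transition[OF M \<phi> \<phi>'(1) p(1) \<phi>'(2), symmetric])
    finally show ?thesis .
  qed
  interpret M: metric_field "metric M \<phi>" "snd \<phi> ` fst \<phi>" by (rule metric_field_chart[OF M \<phi>])
  interpret N: metric_field "metric N \<psi>" "snd \<psi> ` fst \<psi>" by (rule metric_field_chart[OF N \<psi>])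
  show ?thesis
  proof
    show "open (snd \<phi> ` (fst \<phi> \<inter> f -` fst \<psi>))"
      by (intro chart_open_image[OF cM[OF \<phi>]] opA opM opN \<phi> \<psi>) auto
    show "?F y \<in> snd \<psi> ` fst \<psi>" if "y \<in> snd \<phi> ` (fst \<phi> \<inter> f -` fst \<psi>)" for y
      using that by (auto simp: local_rep_coord[OF cM[OF \<phi>]])
  qed (auto simp: smooth \<phi> \<psi> iso)
qed

section \<open>The curvature identities on the manifolds\<close>

lemma independent_orthogonal:
  assumes "pos_form g" "u \<noteq> 0" "v \<noteq> 0" "g u v = 0"
  shows "u \<noteq> v" "independent {u, v}"
proof -
  interpret pos_form g by fact
  show "u \<noteq> v" using assms zero_iff by auto
  have "u \<notin> span {v}"
  proof
    assume "u \<in> span {v}"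
    then have "g u u = 0" by (rule orthogonal_span[rotated]) (use assms in auto)
    then show False using assms zero_iff by auto
  qed
  then show "independent {u, v}" using assms by (simp add: independent_insert)
qed

text \<open>J u is orthogonal to u and equally long, so the Gram determinant of u, J u is |u|^4 and
  the space form condition becomes the quartic identity required by
  \<open>curvature_totally_real\<close>. The zero vector spans no plane and is treated
  apart.\<close>

lemma complex_space_form_curvature:
  assumes N: "complex_space_form N (4 * c)" and p: "p \<in> topspace (top_sp N)"
    and tr: "metric_at N p (J X) Y = 0"
  defines "g \<equiv> metric_at N p"
  shows "g (curvature (metric_near N p) (coords_at N p) X Y Y) X = c * (g X X * g Y Y - (g X Y)\<^sup>2)"
proof -
  have R: "riemannian_manifold N" and k: "kaehler_manifold N"
    using N by (auto simp: complex_space_form_def kaehler_manifold_def)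
  let ?\<phi> = "chart_at N p" and ?x = "coords_at N p"
  let ?V = "snd ?\<phi> ` fst ?\<phi>"
  note \<phi> = chart_at_mem[OF R p]
  interpret metric_field "metric_near N p" ?V
    unfolding metric_near_def by (rule metric_field_chart[OF R \<phi>(1)])
  interpret kaehler_field "metric_near N p" ?V
    using k \<phi>(1) by unfold_locales (auto simp: kaehler_manifold_def metric_near_def)
  have x: "?x \<in> ?V" using \<phi>(2) by (simp add: coords_at_def)
  interpret P: pos_form g unfolding g_def metric_at_def by (rule pos_form[OF x])
  have geq: "metric_near N p ?x = g" by (simp add: g_def metric_at_def)
  have "g (R ?x u (J u) (J u)) u = 4 * c * (g u u)\<^sup>2" for u
  proof (cases "u = 0")
    case True
    then show ?thesis by (simp add: P.simps)
  next
    case False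
    have "g u (J u) = - g u (J u)" using g_J[OF x, of u u] P.sym[of "J u" u] by (simp add: geq)
    then have 0: "g u (J u) = 0" by simp
    have JJ: "g (J u) (J u) = g u u" using J_inv[OF x, of u u] by (simp add: geq)
    then have "J u \<noteq> 0" using False P.zero_iff by metis
    note ind = independent_orthogonal[OF P.pos_form_axioms False this 0]
    have "4 * c = sectional_curvature N p (span {u, J u})"
      using N p False by (simp add: complex_space_form_def)
    also have "\<dots> = g (R ?x u (J u) (J u)) u / (g u u * g (J u) (J u) - (g u (J u))\<^sup>2)"
      unfolding g_def
      by (rule sectional_curvature_span[OF P.pos_form_axioms[unfolded g_def] _ ind(2,1)])
        (use curvature_scale[OF x] in \<open>simp add: metric_at_def\<close>)
    finally show ?thesis
      using P.zero_iff[of u] False by (simp add: JJ 0 power2_eq_square field_simps)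
  qed
  then show ?thesis
    using curvature_totally_real[OF x, of c X Y] tr unfolding geq g_def by simp
qed

text \<open>For orthonormal u, v the images are orthonormal and J dF(u) is orthogonal to dF(v), so
  the ambient term of Gauss's equation is c.\<close>

lemma minimal_totally_real_gauss:
  fixes M :: "('p, 'a::euclidean_space) riem_space" and N :: "('q, complex^'m) riem_space"
  assumes M: "riemannian_manifold M" and N: "complex_space_form N (4 * c)"
    and f: "isometric_immersion M N f" and tr: "totally_real M N f" and mini: "minimal_immersion M N f"
    and p: "p \<in> topspace (top_sp M)"
  shows "\<exists>\<sigma>. minimal_gauss (metric_at M p) (metric_at N (f p)) \<sigma> (sectional_curvature M p) c"
proof -
  have RN: "riemannian_manifold N"
    using N by (auto simp: complex_space_form_def kaehler_manifold_def)
  have fp: "f p \<in> topspace (top_sp N)"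
    using f p by (auto simp: isometric_immersion_def smooth_map_def continuous_map_def)
  define \<phi> where "\<phi> = chart_at M p"
  define \<psi> where "\<psi> = chart_at N (f p)"
  define F where "F = local_rep \<phi> \<psi> f"
  define x where "x = coords_at M p"
  have \<phi>: "\<phi> \<in> atlas M" "p \<in> fst \<phi>" using chart_at_mem[OF M p] by (auto simp: \<phi>_def)
  have \<psi>: "\<psi> \<in> atlas N" "f p \<in> fst \<psi>" using chart_at_mem[OF RN fp] by (auto simp: \<psi>_def)
  interpret I: isometric_field "metric M \<phi>" "snd \<phi> ` fst \<phi>" "metric N \<psi>" "snd \<psi> ` fst \<psi>"
    F "snd \<phi> ` (fst \<phi> \<inter> f -` fst \<psi>)"
    unfolding F_def by (rule isometric_immersion_chart[OF M RN f \<phi>(1) \<psi>(1)])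
  have xW: "x \<in> snd \<phi> ` (fst \<phi> \<inter> f -` fst \<psi>)" using \<phi> \<psi> by (auto simp: x_def coords_at_def \<phi>_def)
  note xU = I.W_U[OF xW]
  have Fx: "F x = coords_at N (f p)"
    using local_rep_coord[OF riemannian_is_chart[OF M \<phi>(1)] \<phi>(2)]
    by (simp add: F_def x_def coords_at_def \<phi>_def \<psi>_def)
  have gM: "metric_near M p = metric M \<phi>" "metric_at M p = metric M \<phi> x"
    and gN: "metric_near N (f p) = metric N \<psi>" "metric_at N (f p) = metric N \<psi> (F x)"
    unfolding Fx by (simp_all add: metric_at_def metric_near_def \<phi>_def \<psi>_def x_def)
  have tm: "tangent_map M N f p = D F x" and rep: "rep_at M N f p = F"
    by (simp_all add: tangent_map_def rep_at_def F_def \<phi>_def \<psi>_def x_def)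
  interpret g: pos_form "metric_at M p" unfolding gM by (rule I.M.pos_form[OF xU])
  interpret h: pos_form "metric_at N (f p)" unfolding gN by (rule I.N.pos_form[OF I.F_in[OF xW]])
  let ?g = "metric_at M p" and ?h = "metric_at N (f p)"
  \<comment> \<open>\<open>I.sff\<close> meets the condition in \<open>normal_part\<close>; any
    other solution differs from it by a tangent vector that is also normal, hence zero by
    positivity.\<close>
  have sff: "second_fundamental_form M N f p u v = I.sff x u v" for u v
  proof -
    have "second_fundamental_form M N f p u v = normal_part M N f p (I.hess x u v)"
      unfolding second_fundamental_form_def I.hess_def rep tm gN(1) Fx x_def[symmetric] ..
    also have "\<dots> = I.sff x u v"
      unfolding normal_part_def
    proof (rule the_equality)
      show "I.sff x u v \<in> normal_space M N f p \<and> I.hess x u v - I.sff x u v \<in> range (tangent_map M N f p)"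
        unfolding normal_space_def tm gN(2) using I.sff_normal[OF xW] by (auto simp: I.sff_def)
      fix \<xi> assume \<xi>: "\<xi> \<in> normal_space M N f p \<and> I.hess x u v - \<xi> \<in> range (tangent_map M N f p)"
      then obtain a where a: "I.hess x u v - \<xi> = D F x a" unfolding tm by blast
      let ?b = "christoffel (metric M \<phi>) x u v - a"
      have d: "\<xi> - I.sff x u v = D F x ?b"
        using a unfolding I.sff_def linear_diff[OF I.linear_DF[OF xW]] by (simp add: algebra_simps)
      have "?h (\<xi> - I.sff x u v) (D F x ?b) = 0"
        using \<xi> I.sff_normal[OF xW, of u v ?b] unfolding normal_space_def tm h.simps by (simp add: gN(2))
      then have "?g ?b ?b = 0" unfolding d gN(2) I.isom[OF xW] gM(2) .
      then have "?b = 0" by (simp only: g.zero_iff)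
      then have "D F x ?b = 0" by (simp only: linear_0[OF I.linear_DF[OF xW]])
      then show "\<xi> = I.sff x u v" using d by simp
    qed
    finally show ?thesis .
  qed
  have "minimal_gauss ?g ?h (I.sff x) (sectional_curvature M p) c"
  proof
    show bil: "bilinear (I.sff x)" by (rule I.bilinear_sff[OF xW])
    show sym: "I.sff x u v = I.sff x v u" for u v by (rule I.sff_sym[OF xW])
    show "(\<Sum>e\<in>C. I.sff x e e) = 0" if C: "orthonormal_basis ?g C" for C
    proof -
      \<comment> \<open>Minimality speaks of the one basis picked by \<open>SOME\<close>; the trace
        carries it to every orthonormal basis.\<close>
      let ?B = "SOME B. orthonormal_basis ?g B"
      have B: "orthonormal_basis ?g ?B" using C by (rule someI)
      have "mean_curvature M N f p = 0" using mini p by (simp add: minimal_immersion_def)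
      then have "(\<Sum>e\<in>?B. I.sff x e e) = 0" by (simp add: mean_curvature_def sff)
      then show ?thesis using g.trace_basis_independent[OF bil C B] by simp
    qed
    fix u v assume uv: "u \<noteq> v" "g.orthonormal {u, v}"
    then have g1: "?g u u = 1" "?g v v = 1" "?g u v = 0" by (auto simp: g.orthonormal_def)
    let ?R = "curvature (metric_near N (f p)) (coords_at N (f p)) (D F x u) (D F x v) (D F x v)"
    have iso: "?h (D F x a) (D F x b) = ?g a b" for a b
      unfolding gN(2) gM(2) by (rule I.isom[OF xW])
    have "J ` range (tangent_map M N f p) \<subseteq> normal_space M N f p"
      using tr p by (simp add: totally_real_def)
    then have "J (D F x u) \<in> normal_space M N f p" unfolding tm by blast
    then have "?h (J (D F x u)) (D F x v) = 0" by (simp add: normal_space_def tm)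
    from complex_space_form_curvature[OF N fp this]
    have "?h ?R (D F x u) = c" by (simp add: iso g1)
    then have "?g (curvature (metric_near M p) (coords_at M p) u v v) u =
        c + ?h (I.sff x v v) (I.sff x u u) - ?h (I.sff x u v) (I.sff x u v)"
      using I.gauss[OF xW, of u v v u, unfolded sym[of v u]]
      unfolding gM gN Fx[symmetric] x_def[symmetric] by linarith
    then have "?g (curvature (metric_near M p) (coords_at M p) u v v) u =
        c + ?h (I.sff x u u) (I.sff x v v) - ?h (I.sff x u v) (I.sff x u v)"
      by (simp only: h.sym[of "I.sff x v v" "I.sff x u u"])
    moreover have "sectional_curvature M p (span {u, v}) =
        ?g (curvature (metric_near M p) (coords_at M p) u v v) u / (?g u u * ?g v v - (?g u v)\<^sup>2)"
    proof (rule sectional_curvature_span[OF g.pos_form_axioms])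
      show "independent {u, v}" by (rule g.orthonormal_independent[OF uv(2)])
    qed (use uv I.M.curvature_scale[OF xU] in \<open>simp_all add: gM x_def[symmetric]\<close>)
    ultimately show "sectional_curvature M p (span {u, v}) =
        c + ?h (I.sff x u u) (I.sff x v v) - ?h (I.sff x u v) (I.sff x u v)"
      by (simp add: g1)
  qed
  then show ?thesis by (rule exI[of _ "I.sff x"])
qed

text \<open>The point type \<open>'q\<close> and the index type \<open>'m\<close> are arbitrary,
  which expresses arbitrary codimension.\<close>

theorem corollary5p2:
  fixes c :: real
    and M :: "('p, 'a::euclidean_space) riem_space"
  assumes "riemannian_manifold M"
    and "einstein M"
    and "\<exists>q::nat. 1 \<le> q \<and> real q \<le> real DIM('a) / 2 \<and>
           (\<exists>p\<in>topspace (top_sp M).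
              delta_Ric M q p > (real DIM('a) - 1 - 2 * real q / real DIM('a)) * c)"
  shows "\<not> (\<exists>(N :: ('q, complex^'m) riem_space) f.
            complex_space_form N (4 * c) \<and> isometric_immersion M N f \<and>
            totally_real M N f \<and> minimal_immersion M N f)"
proof
  assume "\<exists>(N :: ('q, complex^'m) riem_space) f.
            complex_space_form N (4 * c) \<and> isometric_immersion M N f \<and>
            totally_real M N f \<and> minimal_immersion M N f"
  then obtain N :: "('q, complex^'m) riem_space" and f
    where N: "complex_space_form N (4 * c)" "isometric_immersion M N f"
      "totally_real M N f" "minimal_immersion M N f" by blast
  obtain q p where q: "1 \<le> q" "real q \<le> real DIM('a) / 2" and p: "p \<in> topspace (top_sp M)"
    and gt: "delta_Ric M q p > (real DIM('a) - 1 - 2 * real q / real DIM('a)) * c"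
    using assms(3) by blast
  obtain \<sigma> where "minimal_gauss (metric_at M p) (metric_at N (f p)) \<sigma> (sectional_curvature M p) c"
    using minimal_totally_real_gauss[OF assms(1) N p] by blast
  then interpret minimal_gauss "metric_at M p" "metric_at N (f p)" \<sigma> "sectional_curvature M p" c .
  let ?n = "real DIM('a)"
  \<comment> \<open>Existence for the \<open>SOME\<close> in \<open>ricci\<close>.\<close>
  have extend: "\<exists>B. orthonormal_basis (metric_at M p) B \<and> u \<in> B" if u: "u \<in> unit_tangent M p" for u
  proof -
    have "orthonormal {u}" using u by (simp add: orthonormal_def unit_tangent_def)
    then show ?thesis by (rule orthonormal_basis_extend) blast
  qed
  obtain C where C: "orthonormal_basis (metric_at M p) C"
    using orthonormal_basis_extend[of "{}"] by (auto simp: orthonormal_def)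
  \<comment> \<open>A Euclidean space has n \<ge> 1, so there are unit vectors and the supremum is
    over a nonempty set.\<close>
  have "C \<noteq> {}" using orthonormal_basis_card[OF C] by auto
  then obtain u0 where "u0 \<in> C" by blast
  then have u0: "u0 \<in> unit_tangent M p" using C by (simp add: orthonormal_basis_iff orthonormal_def unit_tangent_def)
  define \<rho> where "\<rho> = ricci M p u0"
  have \<rho>: "ricci M p u = \<rho>" if "u \<in> unit_tangent M p" for u
    using assms(2) p u0 that unfolding einstein_def \<rho>_def by blast
  have ric: "\<exists>B. orthonormal_basis (metric_at M p) B \<and> u \<in> B \<and>
      \<rho> = (\<Sum>e\<in>B - {u}. sectional_curvature M p (span {u, e}))" if "metric_at M p u u = 1" for u
  proof -
    have u: "u \<in> unit_tangent M p" using that by (simp add: unit_tangent_def)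
    let ?B = "SOME B. orthonormal_basis (metric_at M p) B \<and> u \<in> B"
    have "orthonormal_basis (metric_at M p) ?B \<and> u \<in> ?B" using someI_ex[OF extend[OF u]] .
    moreover have "\<rho> = (\<Sum>e\<in>?B - {u}. sectional_curvature M p (span {u, e}))"
      using \<rho>[OF u] by (simp add: ricci_def Let_def)
    ultimately show ?thesis by blast
  qed
  let ?S = "{(\<Sum>i<q. sectional_curvature M p (\<pi> i)) / real q |\<pi>. orthogonal_planes M p q \<pi>}"
  \<comment> \<open>The inequality of \<open>ricci_planes_bound\<close> solved for the mean of the
    plane curvatures: a lower bound common to all families.\<close>
  let ?r = "(\<rho> - (?n - 1 - 2 * real q / ?n) * c) * (?n / (2 * real q))"
  have n: "?n > 0" "real q > 0" using q by simp_all
  have "?r \<le> K_inf M q p"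
    unfolding K_inf_def
  proof (rule cInf_greatest)
    have "real (2 * q) \<le> ?n" using q(2) by simp
    then have "2 * q \<le> DIM('a)" by (simp only: of_nat_le_iff)
    from exists_orthogonal_planes[OF this] show "?S \<noteq> {}"
      by (auto simp: orthogonal_planes_def)
    fix s assume "s \<in> ?S"
    then obtain \<pi> where \<pi>: "orthogonal_planes M p q \<pi>" and s: "s = (\<Sum>i<q. sectional_curvature M p (\<pi> i)) / real q"
      by blast
    have "\<rho> - 2 / ?n * (\<Sum>i<q. sectional_curvature M p (\<pi> i)) \<le> (?n - 1 - 2 * real q / ?n) * c"
      by (rule ricci_planes_bound[OF ric]) (use \<pi> in \<open>simp_all add: orthogonal_planes_def\<close>)
    then have "\<rho> - (?n - 1 - 2 * real q / ?n) * c \<le> (2 * real q / ?n) * s"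
      using n by (simp add: s)
    from mult_right_mono[OF this, of "?n / (2 * real q)"] show "?r \<le> s" using n by simp
  qed
  from mult_left_mono[OF this, of "2 * real q / ?n"]
  have "\<rho> - (?n - 1 - 2 * real q / ?n) * c \<le> 2 * real q / ?n * K_inf M q p" using n by simp
  moreover have "(SUP u\<in>unit_tangent M p. ricci M p u) = \<rho>"
  proof -
    have "ricci M p ` unit_tangent M p = {\<rho>}" using \<rho> u0 by auto
    then show ?thesis by simp
  qed
  ultimately show False using gt by (simp add: delta_Ric_def)
qed

end
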